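(* There exists a finite set $E\subset[1,\infty)$ of real algebraic numbers such that the function $\mu\colon[1,\infty)\setminus E\longrightarrow\mathbb{R}$ is real-analytic.
   Context: Definition of $\mu$. For real $r\ge 1$, let $C_1$ and $C_r$ be circles of radii $1$ and $r$, respectively, which are (externally) tangent to each other and both tangent to a common line $L$, lying on the same side of $L$. In coordinates one may take $L=\{y=0\}$, $C_1$ with center $(0,1)$ and $C_r$ with center $(2\sqrt r,r)$. Consider the closed bounded curvilinear triangular region enclosed by $C_1$, $C_r$ and $L$ (bounded by the segment of $L$ between the two points of tangency with $L$, and by the arcs of $C_1$ and $C_r$ joining these points to the point of tangency of the two circles). Among all squares (of arbitrary orientation) contained in this region and touching each of $C_1$, $C_r$ and $L$, $\mu(r)$ denotes the minimal possible side length. Known characterization of $\mu$ recalled from earlier work (Holly and Krumm, 2021): for each $r\ge 1$, $\mu(r)$ is the minimum value on the interval $(1-1/\sqrt2,\,1)$ of the function $$z_r(x)=\sqrt{x^{2}+\Bigl(r-x-\sqrt{r^{2}-\bigl(2\sqrt r-x-\sqrt{2x-x^{2}}\bigr)^{2}}\Bigr)^{2}}.$$ A function on a subset of $[1,\infty)$ is real-analytic if near each point of its domain it agrees with a convergent power series centered at that point (at the endpoint $1$, if it belongs to the domain: it agrees on some $[1,1+\varepsilon)$ with a function real-analytic in an open neighborhood of $1$). *)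

theory Defs
  imports "HOL-Analysis.Analysis" "HOL-Computational_Algebra.Polynomial"
begin

text \<open>The plane is identified with the complex numbers, and the line \<open>L\<close> with the real axis.\<close>

definition line_L :: "complex set" where
  "line_L = {z. Im z = 0}"

definition center1 :: complex where
  "center1 = Complex 0 1"

definition center_r :: "real \<Rightarrow> complex" where
  "center_r r = Complex (2 * sqrt r) r"

text \<open>The curvilinear triangle has vertices \<open>0\<close> and \<open>2 * sqrt r\<close> (the points of tangency with
  \<open>L\<close>) and the point of tangency of the two circles. Both circles bulge into the straight triangle
  with these vertices: the chord joining two tangency points of a circle lies in its disc, and the
  arc in question stays in the straight triangle since its end tangents are \<open>L\<close> and the common
  inner tangent of the circles, which meets \<open>L\<close> at \<open>sqrt r\<close>. Hence removing the open discs from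
  the straight triangle leaves exactly the closed region bounded by the segment of \<open>L\<close> and the two
  arcs.\<close>

definition tangency_point :: "real \<Rightarrow> complex" where
  "tangency_point r = Complex (2 * sqrt r / (1 + r)) (2 * r / (1 + r))"

definition region :: "real \<Rightarrow> complex set" where
  "region r = convex hull {0, Complex (2 * sqrt r) 0, tangency_point r}
                - ball center1 1 - ball (center_r r) r"

text \<open>The (filled) square with vertex \<open>p\<close> and side vector \<open>v\<close>, the remaining vertices following
  counterclockwise. For \<open>v \<noteq> 0\<close> this yields every square, of every orientation, with side length
  \<open>norm v\<close>.\<close>

definition square :: "complex \<Rightarrow> complex \<Rightarrow> complex set" where
  "square p v = convex hull {p, p + v, p + v + \<i> * v, p + \<i> * v}"

definition admissible_side :: "real \<Rightarrow> real \<Rightarrow> bool" where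
  "admissible_side r s \<longleftrightarrow>
     (\<exists>p v. v \<noteq> 0 \<and> s = norm v \<and> square p v \<subseteq> region r \<and>
            square p v \<inter> sphere center1 1 \<noteq> {} \<and>
            square p v \<inter> sphere (center_r r) r \<noteq> {} \<and>
            square p v \<inter> line_L \<noteq> {})"

definition mu :: "real \<Rightarrow> real" where
  "mu r = (LEAST s. admissible_side r s)"

text \<open>The power series is required to converge on a full neighbourhood of \<open>x\<close>, but to agree with
  \<open>f\<close> only on \<open>S\<close>. At an interior point of \<open>S\<close> this is ordinary real-analyticity. At a boundary
  point such as \<open>1\<close> in \<open>{1..}\<close> it says that \<open>f\<close> agrees on some \<open>{1..<1 + e}\<close> with a function that is
  real-analytic in an open neighbourhood of \<open>1\<close>.\<close>

definition real_analytic_on :: "(real \<Rightarrow> real) \<Rightarrow> real set \<Rightarrow> bool" where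
  "real_analytic_on f S \<longleftrightarrow>
     (\<forall>x\<in>S. \<exists>a :: nat \<Rightarrow> real. \<exists>e>0. \<forall>y. \<bar>y - x\<bar> < e \<longrightarrow>
        summable (\<lambda>n. a n * (y - x) ^ n) \<and>
        (y \<in> S \<longrightarrow> f y = (\<Sum>n. a n * (y - x) ^ n)))"

end

theory Submission
  imports Defs "HOL-Complex_Analysis.Complex_Analysis"
begin

text \<open>
  The idea: \<open>\<mu>\<close> is defined by a first-order formula over the ordered field of real numbers whose
  coefficients are integers, and every function with such a definition is real-analytic away from
  finitely many algebraic points. That a square lies in the region, that it touches a circle or the
  line, and that its side is least possible are all expressed by polynomial equations and
  inequalities and by quantifiers over real numbers (\<open>semialgebraic_least_admissible\<close>).

  Quantifiers are eliminated by the method of Cohen and Hoermander. Two families of univariate real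
  polynomials look alike if the real line can be matched with itself so that corresponding
  polynomials have equal signs at matched points and no sign change is met in the wrong order
  (\<open>sign_corr\<close>). If the families contain the derivative of a further polynomial \<open>P\<close> and agree on
  the signs of \<open>P\<close> at all their roots, then \<open>P\<close> can be added to them, since it is strictly monotone
  between consecutive roots (\<open>sign_corr_extend\<close>). The sign of \<open>P\<close> at a root of \<open>q\<close> is the sign of
  the remainder of \<open>P\<close> modulo \<open>q\<close>, so everything reduces to lower degree, and by induction the
  matching exists as soon as two parameters agree on the signs of finitely many integer polynomials
  (\<open>determined_param_poly\<close>). Hence the truth of a formula depends only on such signs
  (\<open>semialgebraic_projection\<close>).

  Now let \<open>G x y\<close> be a formula satisfied by at most one \<open>y\<close> for each \<open>x\<close>. Only finitely many integer
  polynomials in \<open>x\<close> control the picture over \<open>x\<close>; let \<open>E\<close> be the set of roots of the nonzero ones. Off \<open>E\<close> the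
  pictures over neighbouring points match. The unique \<open>y\<close> over \<open>x\<close> has to be a root of one of the
  polynomials, and after passing to a higher derivative it is a simple root. Matched roots stay
  close (\<open>corresponding_roots_near\<close>), so near \<open>x\<close> the solution is a continuous choice of a simple
  root, and the analytic implicit function theorem finishes the argument
  (\<open>semialgebraic_function_analytic\<close>). Where no least admissible side exists, \<open>LEAST\<close> denotes one
  fixed number, so there \<open>\<mu>\<close> is constant.
\<close>

section \<open>Signs of a univariate polynomial\<close>

lemma poly_root_between:
  fixes P :: "real poly"
  assumes "sgn (poly P a) \<noteq> sgn (poly P b)"
  shows "\<exists>t. min a b \<le> t \<and> t \<le> max a b \<and> poly P t = 0"
proof (rule ccontr)
  assume n: "\<not> ?thesis"
  have *: "\<exists>t. a \<le> t \<and> t \<le> b \<and> poly P t = 0" if "a \<le> b" "sgn (poly P a) \<noteq> sgn (poly P b)" for a b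
  proof -
    have "isCont (poly P) x" for x by simp
    moreover have "(poly P a \<le> 0 \<and> 0 \<le> poly P b) \<or> (poly P b \<le> 0 \<and> 0 \<le> poly P a)"
      using that(2) by (auto simp: sgn_if split: if_splits)
    ultimately show ?thesis
      using IVT[of "poly P" a 0 b] IVT2[of "poly P" b 0 a] that(1) by blast
  qed
  show False
    using n *[of a b] *[of b a] assms by (cases "a \<le> b") (auto simp: min_def max_def)
qed

lemma poly_nonzero_between:
  fixes P :: "real poly"
  assumes "P \<noteq> 0" "a < b"
  obtains t where "a < t" "t < b" "poly P t \<noteq> 0"
proof -
  have "finite {t. poly P t = 0}" using assms(1) by (rule poly_roots_finite)
  moreover have "infinite {a<..<b}" using assms(2) by simp
  ultimately have "\<not> {a<..<b} \<subseteq> {t. poly P t = 0}" using finite_subset by blast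
  then obtain t where "t \<in> {a<..<b}" "poly P t \<noteq> 0" by blast
  then show ?thesis using that[of t] by auto
qed

lemma poly_strict_mono_of_pderiv_pos:
  fixes P :: "real poly"
  assumes "a < b" "\<And>t. a < t \<Longrightarrow> t < b \<Longrightarrow> poly (pderiv P) t > 0"
  shows "poly P a < poly P b"
proof (rule DERIV_pos_imp_increasing_open[OF assms(1)])
  show "\<exists>y. (poly P has_real_derivative y) (at t) \<and> 0 < y" if "a < t" "t < b" for t
    using assms(2)[OF that] poly_DERIV by blast
qed (auto intro: continuous_intros)

lemma poly_same_sign_near:
  fixes Q :: "real poly"
  assumes "sgn (poly Q c) = \<sigma>" "\<sigma> \<noteq> 0"
  obtains d where "d > 0" "\<And>t. \<bar>t - c\<bar> < d \<Longrightarrow> sgn (poly Q t) = \<sigma>"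
proof -
  have "isCont (poly Q) c" by simp
  moreover have "poly Q c \<noteq> 0" using assms by auto
  ultimately obtain d where d: "d > 0" "\<And>t. \<bar>t - c\<bar> < d \<Longrightarrow> \<bar>poly Q t - poly Q c\<bar> < \<bar>poly Q c\<bar>"
    unfolding continuous_at_eps_delta dist_real_def by (metis abs_minus_commute zero_less_abs_iff)
  have "sgn (poly Q t) = \<sigma>" if "\<bar>t - c\<bar> < d" for t
    using d(2)[OF that] assms by (auto simp: sgn_if split: if_splits)
  with d(1) that show ?thesis by blast
qed

section \<open>Matched families of polynomials\<close>

text \<open>\<open>R\<close> matches the points of the line carrying \<open>P\<close> with the points of the line carrying \<open>Q\<close>. It need
  not be monotone: on an interval where all signs are constant the points may be matched in any
  order. Only a reversal of order across a sign change is excluded, and this weak form survives when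
  further polynomials are added.\<close>

definition sign_match :: "real poly \<Rightarrow> real poly \<Rightarrow> (real \<Rightarrow> real \<Rightarrow> bool) \<Rightarrow> bool" where
  "sign_match P Q R \<longleftrightarrow>
     (\<forall>x x'. R x x' \<longrightarrow> sgn (poly P x) = sgn (poly Q x')) \<and>
     (\<forall>x x' z z'. R x x' \<longrightarrow> R z z' \<longrightarrow> x < z \<longrightarrow> z' < x' \<longrightarrow>
        (\<forall>t\<in>{x..z}. sgn (poly P t) = sgn (poly P x)) \<and>
        (\<forall>t\<in>{z'..x'}. sgn (poly Q t) = sgn (poly Q z')))"

definition sign_corr ::
  "'i set \<Rightarrow> ('i \<Rightarrow> real poly) \<Rightarrow> ('i \<Rightarrow> real poly) \<Rightarrow> (real \<Rightarrow> real \<Rightarrow> bool) \<Rightarrow> bool" where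
  "sign_corr I p q R \<longleftrightarrow> bi_total R \<and> (\<forall>i\<in>I. sign_match (p i) (q i) R)"

lemma sign_match_sym: "sign_match P Q R \<Longrightarrow> sign_match Q P R\<inverse>\<inverse>"
proof -
  assume "sign_match P Q R"
  then have s: "\<And>x x'. R x x' \<Longrightarrow> sgn (poly P x) = sgn (poly Q x')"
    and c: "\<And>x x' z z'. R x x' \<Longrightarrow> R z z' \<Longrightarrow> x < z \<Longrightarrow> z' < x' \<Longrightarrow>
        (\<forall>t\<in>{x..z}. sgn (poly P t) = sgn (poly P x)) \<and>
        (\<forall>t\<in>{z'..x'}. sgn (poly Q t) = sgn (poly Q z'))"
    unfolding sign_match_def by blast+
  show ?thesis
    unfolding sign_match_def conversep_iff
  proof (intro conjI allI impI)
    fix x x' assume "R x' x"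
    then show "sgn (poly Q x) = sgn (poly P x')" by (rule s[symmetric])
  next
    fix x x' z z' assume "R x' x" "R z' z" "x < z" "z' < x'"
    from c[OF this(2,1,4,3)]
    show "\<forall>t\<in>{x..z}. sgn (poly Q t) = sgn (poly Q x)"
      and "\<forall>t\<in>{z'..x'}. sgn (poly P t) = sgn (poly P z')" by blast+
  qed
qed

lemma sign_corr_sym: "sign_corr I p q R \<Longrightarrow> sign_corr I q p R\<inverse>\<inverse>"
  unfolding sign_corr_def bi_total_conversep
  by (rule conjI, erule conjunct1, rule ballI, rule sign_match_sym, drule conjunct2, erule bspec)

lemma sign_corr_subset: "sign_corr I p q R \<Longrightarrow> J \<subseteq> I \<Longrightarrow> sign_corr J p q R"
  unfolding sign_corr_def by blast

lemma sign_corr_left: "sign_corr I p q R \<Longrightarrow> \<exists>x'. R x x'"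
  and sign_corr_right: "sign_corr I p q R \<Longrightarrow> \<exists>x. R x x'"
  unfolding sign_corr_def bi_total_def by blast+

lemma
  assumes "sign_corr I p q R" "i \<in> I"
  shows sign_corr_sgn: "R x x' \<Longrightarrow> sgn (poly (p i) x) = sgn (poly (q i) x')"
    and sign_corr_const:
      "\<lbrakk>R x x'; R z z'; x < z; z' < x'; x \<le> t; t \<le> z\<rbrakk> \<Longrightarrow> sgn (poly (p i) t) = sgn (poly (p i) x)"
      "\<lbrakk>R x x'; R z z'; x < z; z' < x'; z' \<le> t; t \<le> x'\<rbrakk> \<Longrightarrow> sgn (poly (q i) t) = sgn (poly (q i) z')"
proof -
  have m: "sign_match (p i) (q i) R"
    using assms unfolding sign_corr_def by (elim conjE bspec)
  note c = m[unfolded sign_match_def, THEN conjunct1, rule_format]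
    and d = m[unfolded sign_match_def, THEN conjunct2, rule_format]
  show "R x x' \<Longrightarrow> sgn (poly (p i) x) = sgn (poly (q i) x')" by (rule c)
  {
    assume "R x x'" "R z z'" "x < z" "z' < x'"
    note dd = d[OF this]
    show "sgn (poly (p i) t) = sgn (poly (p i) x)" if "x \<le> t" "t \<le> z"
      by (rule dd[THEN conjunct1, THEN bspec]) (use that in simp)
    show "sgn (poly (q i) t) = sgn (poly (q i) z')" if "z' \<le> t" "t \<le> x'"
      by (rule dd[THEN conjunct2, THEN bspec]) (use that in simp)
  }
qed

definition roots :: "'i set \<Rightarrow> ('i \<Rightarrow> real poly) \<Rightarrow> real set" where
  "roots I p = {z. \<exists>i\<in>I. p i \<noteq> 0 \<and> poly (p i) z = 0}"

lemma finite_roots: "finite I \<Longrightarrow> finite (roots I p)"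
proof -
  assume "finite I"
  moreover have "roots I p = (\<Union>i\<in>{i\<in>I. p i \<noteq> 0}. {z. poly (p i) z = 0})"
    unfolding roots_def by auto
  ultimately show ?thesis by (simp add: poly_roots_finite)
qed

lemma sign_corr_zero_iff:
  assumes "sign_corr I p q R" "i \<in> I"
  shows "p i = 0 \<longleftrightarrow> q i = 0"
proof -
  have *: "q i = 0" if s: "sign_corr I p q R" and "p i = 0" for p q :: "_ \<Rightarrow> real poly" and R
  proof -
    have "poly (q i) x' = 0" for x'
      using sign_corr_right[OF s, of x'] sign_corr_sgn[OF s assms(2)] that(2)
      by (metis poly_0 sgn_0 sgn_0_0)
    then show ?thesis using poly_all_0_iff_0 by blast
  qed
  show ?thesis using *[OF assms(1)] *[OF sign_corr_sym[OF assms(1)]] by blast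
qed

lemma sign_corr_root:
  assumes "sign_corr I p q R" "R z z'"
  shows "z \<in> roots I p \<longleftrightarrow> z' \<in> roots I q"
proof -
  have "p i \<noteq> 0 \<and> poly (p i) z = 0 \<longleftrightarrow> q i \<noteq> 0 \<and> poly (q i) z' = 0" if "i \<in> I" for i
    using sign_corr_zero_iff[OF assms(1) that] sign_corr_sgn[OF assms(1) that assms(2)]
    by (metis sgn_zero_iff)
  then show ?thesis unfolding roots_def by blast
qed

text \<open>If a root \<open>z\<close> had two partners \<open>u < w\<close>, some \<open>t\<close> between them would not be a root of the
  corresponding polynomial. A partner \<open>y\<close> of \<open>t\<close> lies on one side of \<open>z\<close>, so that its match is
  reversed against \<open>u\<close> or against \<open>w\<close>, although the sign changes between \<open>t\<close> and that point.\<close>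

lemma sign_corr_root_unique:
  assumes s: "sign_corr I p q R" and z: "z \<in> roots I p" and u: "R z u" and w: "R z w"
  shows "u = w"
proof -
  have False if u: "R z u" and w: "R z w" and "u < w" for u w
  proof -
    obtain i where i: "i \<in> I" "p i \<noteq> 0" "poly (p i) z = 0" using z by (auto simp: roots_def)
    then have "q i \<noteq> 0" using sign_corr_zero_iff[OF s] by blast
    then obtain t where t: "u < t" "t < w" "poly (q i) t \<noteq> 0"
      using poly_nonzero_between \<open>u < w\<close> by blast
    obtain y where y: "R y t" using sign_corr_right[OF s] by blast
    have uw: "poly (q i) u = 0" "poly (q i) w = 0"
      using sign_corr_sgn[OF s i(1) u] sign_corr_sgn[OF s i(1) w] i(3) by (auto simp: sgn_zero_iff)
    consider "y < z" | "y = z" | "z < y" by linarith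
    then show False
    proof cases
      case 1
      then show False using sign_corr_const(2)[OF s i(1) y u, of t] t uw by (auto simp: sgn_zero_iff)
    next
      case 2
      then show False using sign_corr_sgn[OF s i(1) y] i t by (auto simp: sgn_zero_iff)
    next
      case 3
      then show False using sign_corr_const(2)[OF s i(1) w y, of w] t uw by (auto simp: sgn_zero_iff)
    qed
  qed
  then show ?thesis using u w by (metis linorder_neqE_linordered_idom)
qed

text \<open>Around a root the weak monotonicity is genuine: a reversal would make a nonzero polynomial vanish
  on a whole interval.\<close>

lemma sign_corr_root_less:
  assumes s: "sign_corr I p q R" and z: "z \<in> roots I p" "R z z'" and x: "R x x'"
  shows "x < z \<Longrightarrow> x' < z'" and "z < x \<Longrightarrow> z' < x'"
proof -
  have z': "z' \<in> roots I q" using sign_corr_root[OF s z(2)] z(1) by blast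
  have neq: "x' \<noteq> z'" if "x \<noteq> z"
    using sign_corr_root_unique[OF sign_corr_sym[OF s] z', of x z] z(2) x that by auto
  obtain i where i: "i \<in> I" "p i \<noteq> 0" "poly (p i) z = 0" using z by (auto simp: roots_def)
  {
    assume "x < z"
    have "\<not> z' < x'"
    proof
      assume "z' < x'"
      obtain t where "x < t" "t < z" "poly (p i) t \<noteq> 0"
        using poly_nonzero_between i \<open>x < z\<close> by blast
      then show False
        using sign_corr_const(1)[OF s i(1) x z(2) \<open>x < z\<close> \<open>z' < x'\<close>, of t]
          sign_corr_const(1)[OF s i(1) x z(2) \<open>x < z\<close> \<open>z' < x'\<close>, of z] i by (auto simp: sgn_zero_iff)
    qed
    then show "x' < z'" using neq \<open>x < z\<close> by fastforce
  next
    assume "z < x"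
    have "\<not> x' < z'"
    proof
      assume "x' < z'"
      obtain t where "z < t" "t < x" "poly (p i) t \<noteq> 0"
        using poly_nonzero_between i \<open>z < x\<close> by blast
      then show False
        using sign_corr_const(1)[OF s i(1) z(2) x \<open>z < x\<close> \<open>x' < z'\<close>, of t] i by (auto simp: sgn_zero_iff)
    qed
    then show "z' < x'" using neq \<open>z < x\<close> by fastforce
  }
qed

text \<open>The coarsest matching that respects a set \<open>Z\<close> of matched points: it knows only in which gap
  of \<open>Z\<close>, or at which point of \<open>Z\<close>, a point lies.\<close>

definition same_position ::
  "real set \<Rightarrow> (real \<Rightarrow> real \<Rightarrow> bool) \<Rightarrow> real \<Rightarrow> real \<Rightarrow> bool" where
  "same_position Z R x x' \<longleftrightarrow> (\<forall>z z'. z \<in> Z \<longrightarrow> R z z' \<longrightarrow> (x < z \<longleftrightarrow> x' < z') \<and> (z < x \<longleftrightarrow> z' < x'))"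

lemma same_position_sym:
  assumes "sign_corr I p q R" "same_position (roots I p) R x x'"
  shows "same_position (roots I q) R\<inverse>\<inverse> x' x"
  unfolding same_position_def
proof (intro allI impI)
  fix z' z assume "z' \<in> roots I q" "R\<inverse>\<inverse> z' z"
  then have R: "R z z'" and z: "z \<in> roots I p"
    using sign_corr_root[OF assms(1), of z z'] by simp_all
  show "(x' < z') = (x < z) \<and> (z' < x') = (z < x)"
    using assms(2)[unfolded same_position_def, rule_format, OF z R] by linarith
qed

text \<open>Any partner of \<open>x\<close> under \<open>R\<close> lies in the same gap between roots as \<open>x'\<close>, and by the intermediate
  value theorem no member of the family changes its sign inside a gap.\<close>

lemma same_position_sgn:
  assumes s: "sign_corr I p q R" and i: "i \<in> I" and m: "same_position (roots I p) R x x'"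
  shows "sgn (poly (p i) x) = sgn (poly (q i) x')"
proof (rule ccontr)
  assume neq: "sgn (poly (p i) x) \<noteq> sgn (poly (q i) x')"
  obtain x'' where x'': "R x x''" using sign_corr_left[OF s] by blast
  have "sgn (poly (q i) x') \<noteq> sgn (poly (q i) x'')" using sign_corr_sgn[OF s i x''] neq by simp
  then obtain t where t: "min x' x'' \<le> t" "t \<le> max x' x''" "poly (q i) t = 0" and "q i \<noteq> 0"
    using poly_root_between by fastforce
  then have tq: "t \<in> roots I q" using i by (auto simp: roots_def)
  obtain z where z: "R z t" using sign_corr_right[OF s] by blast
  have zp: "z \<in> roots I p" using sign_corr_root[OF s z] tq by simp
  have mz: "(x < z \<longleftrightarrow> x' < t) \<and> (z < x \<longleftrightarrow> t < x')" using m[unfolded same_position_def] zp z by blast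
  consider "x < z" | "x = z" | "z < x" by linarith
  then show False
  proof cases
    case 1
    then have "x'' < t" using sign_corr_root_less(1)[OF s zp z x''] by blast
    moreover have "x' < t" using mz 1 by simp
    ultimately show False using t by auto
  next
    case 2
    then have "x' = t" using mz by (auto simp: sgn_if split: if_splits)
    then show False using sign_corr_sgn[OF s i z] 2 neq by simp
  next
    case 3
    then have "t < x''" using sign_corr_root_less(2)[OF s zp z x''] by blast
    moreover have "t < x'" using mz 3 by simp
    ultimately show False using t by auto
  qed
qed

lemma same_position_between:
  assumes "same_position Z R x x'" "same_position Z R z z'" "x < z" "z' < x'"
  shows "x \<le> t \<Longrightarrow> t \<le> z \<Longrightarrow> same_position Z R t x'"
    and "z' \<le> t \<Longrightarrow> t \<le> x' \<Longrightarrow> same_position Z R x t"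
proof -
  have *: "(u < x \<and> u < z \<and> u' < x' \<and> u' < z') \<or> (x < u \<and> z < u \<and> x' < u' \<and> z' < u')"
    if "u \<in> Z" "R u u'" for u u'
    using assms(1)[unfolded same_position_def, rule_format, OF that]
      assms(2)[unfolded same_position_def, rule_format, OF that] assms(3,4) by linarith
  show "same_position Z R t x'" if "x \<le> t" "t \<le> z"
    unfolding same_position_def
  proof (intro allI impI)
    fix u u' assume "u \<in> Z" "R u u'"
    from *[OF this] that show "(t < u) = (x' < u') \<and> (u < t) = (u' < x')" by linarith
  qed
  show "same_position Z R x t" if "z' \<le> t" "t \<le> x'"
    unfolding same_position_def
  proof (intro allI impI)
    fix u u' assume "u \<in> Z" "R u u'"
    from *[OF this] that show "(x < u) = (t < u') \<and> (u < x) = (u' < t)" by linarith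
  qed
qed

section \<open>Adding a polynomial to matched families\<close>

lemma poly_same_sign_near_in:
  fixes Q :: "real poly"
  assumes "a < b" "\<sigma> \<noteq> 0" "sgn (poly Q a) = \<sigma> \<or> sgn (poly Q b) = \<sigma>"
  shows "\<exists>t. a < t \<and> t < b \<and> sgn (poly Q t) = \<sigma>"
  using assms(3)
proof
  assume "sgn (poly Q a) = \<sigma>"
  then obtain d where d: "d > 0" "\<And>t. \<bar>t - a\<bar> < d \<Longrightarrow> sgn (poly Q t) = \<sigma>"
    using poly_same_sign_near assms(2) by blast
  have "a < a + min d (b - a) / 2" "a + min d (b - a) / 2 < b"
    "\<bar>(a + min d (b - a) / 2) - a\<bar> < d"
    using d(1) assms(1) by (auto simp: min_def field_simps)
  then show ?thesis using d(2) by blast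
next
  assume "sgn (poly Q b) = \<sigma>"
  then obtain d where d: "d > 0" "\<And>t. \<bar>t - b\<bar> < d \<Longrightarrow> sgn (poly Q t) = \<sigma>"
    using poly_same_sign_near assms(2) by blast
  have "a < b - min d (b - a) / 2" "b - min d (b - a) / 2 < b"
    "\<bar>(b - min d (b - a) / 2) - b\<bar> < d"
    using d(1) assms(1) by (auto simp: min_def field_simps)
  then show ?thesis using d(2) by blast
qed

lemma monotone_sign_transfer_pos:
  fixes P Q :: "real poly"
  assumes "a < x" "x < b" "a' < b'"
    and pos: "\<And>t. a < t \<Longrightarrow> t < b \<Longrightarrow> poly (pderiv P) t > 0"
    and sa: "sgn (poly P a) = sgn (poly Q a')" and sb: "sgn (poly P b) = sgn (poly Q b')"
  shows "\<exists>x'. a' < x' \<and> x' < b' \<and> sgn (poly Q x') = sgn (poly P x)"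
proof -
  have ax: "poly P a < poly P x" and xb: "poly P x < poly P b"
    using assms(1,2) by (auto intro!: poly_strict_mono_of_pderiv_pos pos)
  consider "poly P x = 0" | "poly P x > 0" | "poly P x < 0" by linarith
  then show ?thesis
  proof cases
    case 1
    then have "poly Q a' < 0" "0 < poly Q b'"
      using ax xb sa sb by (auto simp: sgn_if split: if_splits)
    moreover from this obtain t where "a' \<le> t" "t \<le> b'" "poly Q t = 0"
      using IVT[of "poly Q" a' 0 b'] assms(3) by auto
    ultimately show ?thesis using 1
      by (intro exI[of _ t]) (metis less_eq_real_def less_irrefl)
  next
    case 2
    then show ?thesis using poly_same_sign_near_in[OF assms(3), of 1 Q] xb sb by simp
  next
    case 3
    then show ?thesis using poly_same_sign_near_in[OF assms(3), of "-1" Q] ax sa by simp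
  qed
qed

lemma poly_nonvanishing_same_sign:
  fixes P :: "real poly"
  assumes "\<And>t. a < t \<Longrightarrow> t < b \<Longrightarrow> poly P t \<noteq> 0"
  shows "(\<forall>t. a < t \<longrightarrow> t < b \<longrightarrow> poly P t > 0) \<or> (\<forall>t. a < t \<longrightarrow> t < b \<longrightarrow> poly P t < 0)"
proof (rule ccontr)
  assume "\<not> ?thesis"
  then obtain s t where st: "a < s" "s < b" "\<not> poly P s > 0" "a < t" "t < b" "\<not> poly P t < 0" by blast
  then have "sgn (poly P s) \<noteq> sgn (poly P t)"
    using assms[of s] assms[of t] by (auto simp: sgn_if)
  then obtain u where "min s t \<le> u" "u \<le> max s t" "poly P u = 0"
    using poly_root_between by blast
  then show False using assms[of u] st by (auto simp: min_def max_def split: if_splits)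
qed

text \<open>On an interval where \<open>P\<close> is strictly monotone, the signs that \<open>P\<close> takes inside are governed by
  its signs at the two ends: a nonzero sign is shared with one of the ends, and a zero inside forces
  opposite nonzero signs at the ends. So any \<open>Q\<close> with the same end signs takes the same signs.\<close>

lemma monotone_sign_transfer:
  fixes P Q :: "real poly"
  assumes "a < x" "x < b" "a' < b'"
    and nz: "\<And>t. a < t \<Longrightarrow> t < b \<Longrightarrow> poly (pderiv P) t \<noteq> 0"
    and sa: "sgn (poly P a) = sgn (poly Q a')" and sb: "sgn (poly P b) = sgn (poly Q b')"
  shows "\<exists>x'. a' < x' \<and> x' < b' \<and> sgn (poly Q x') = sgn (poly P x)"
  using poly_nonvanishing_same_sign[OF nz, of a b]
proof
  assume "\<forall>t. a < t \<longrightarrow> t < b \<longrightarrow> poly (pderiv P) t > 0"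
  then show ?thesis using monotone_sign_transfer_pos[OF assms(1-3) _ sa sb] by blast
next
  assume "\<forall>t. a < t \<longrightarrow> t < b \<longrightarrow> poly (pderiv P) t < 0"
  then show ?thesis
    using monotone_sign_transfer_pos[OF assms(1-3), of "- P" "- Q"] sa sb
    by (simp add: pderiv_minus sgn_minus)
qed

lemma sign_at_top:
  fixes P :: "real poly"
  shows "\<exists>M. \<forall>x\<ge>M. sgn (poly P x) = sgn (lead_coeff P)"
proof -
  have *: "\<exists>M. \<forall>x\<ge>M. sgn (poly P x) = sgn (lead_coeff P)" if "lead_coeff P > 0" for P :: "real poly"
    using poly_pinfty_gt_lc[OF that] that by (metis less_le_trans sgn_pos)
  consider "lead_coeff P = 0" | "lead_coeff P > 0" | "lead_coeff P < 0" by linarith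
  then show ?thesis
  proof cases
    case 3
    then show ?thesis using *[of "- P"] by (simp add: sgn_minus)
  qed (use * in auto)
qed

lemma sign_at_bot:
  fixes P :: "real poly"
  shows "\<exists>M. \<forall>x\<le>M. sgn (poly P x) = (-1) ^ degree P * sgn (lead_coeff P)"
proof -
  obtain M where M: "\<And>x. x \<ge> M \<Longrightarrow> sgn (poly (P \<circ>\<^sub>p [:0, -1:]) x) = sgn (lead_coeff (P \<circ>\<^sub>p [:0, -1:]))"
    using sign_at_top by blast
  have "lead_coeff (P \<circ>\<^sub>p [:0, -1:]) = lead_coeff P * (-1) ^ degree P"
    by (subst lead_coeff_comp) auto
  then have "sgn (poly P x) = (-1) ^ degree P * sgn (lead_coeff P)" if "x \<le> - M" for x
    using M[of "- x"] that by (simp add: poly_pcompose sgn_mult mult.commute)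
  then show ?thesis by blast
qed

text \<open>The situation in which the pair \<open>P\<close>, \<open>Q\<close> can be added to a matched pair of families. Degree and
  sign of the leading coefficient fix the signs at \<open>\<plusminus>\<infinity>\<close>, the derivative makes \<open>P\<close> and \<open>Q\<close> monotone
  between roots, and the last condition fixes their signs at the roots.\<close>

definition extendable ::
  "'i set \<Rightarrow> ('i \<Rightarrow> real poly) \<Rightarrow> ('i \<Rightarrow> real poly) \<Rightarrow> (real \<Rightarrow> real \<Rightarrow> bool) \<Rightarrow> real poly \<Rightarrow> real poly \<Rightarrow> bool" where
  "extendable I p q R P Q \<longleftrightarrow>
     finite I \<and> sign_corr I p q R \<and> degree P = degree Q \<and> 0 < degree P \<and> sgn (lead_coeff P) = sgn (lead_coeff Q) \<and>
     (\<exists>k\<in>I. p k = pderiv P \<and> q k = pderiv Q) \<and>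
     (\<forall>z z'. z \<in> roots I p \<longrightarrow> R z z' \<longrightarrow> sgn (poly P z) = sgn (poly Q z'))"

lemma extendable_sym: "extendable I p q R P Q \<Longrightarrow> extendable I q p R\<inverse>\<inverse> Q P"
proof -
  assume e: "extendable I p q R P Q"
  then have s: "sign_corr I p q R" by (simp add: extendable_def)
  have "sgn (poly Q z') = sgn (poly P z)" if "z' \<in> roots I q" "R z z'" for z z'
    using e sign_corr_root[OF s that(2)] that by (auto simp: extendable_def)
  then show ?thesis using e sign_corr_sym[OF s] by (auto simp: extendable_def)
qed

text \<open>As \<open>a\<close> serves the last root below \<open>x\<close>; without such a root, a point so far to the left that the
  sign of \<open>P\<close> is already its sign at \<open>-\<infinity>\<close>.\<close>

lemma extendable_lower_end:
  assumes e: "extendable I p q R P Q" and x: "x \<notin> roots I p"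
  obtains a a' where "a < x" "sgn (poly P a) = sgn (poly Q a')"
    "\<And>z z'. z \<in> roots I p \<Longrightarrow> R z z' \<Longrightarrow> (z < x \<longrightarrow> z \<le> a \<and> z' \<le> a') \<and> (x < z \<longrightarrow> a' < z')"
proof -
  let ?Z = "roots I p"
  have s: "sign_corr I p q R" and fin: "finite I" using e by (auto simp: extendable_def)
  show ?thesis
  proof (cases "{z\<in>?Z. z < x} = {}")
    case False
    define a where "a = Max {z\<in>?Z. z < x}"
    have f: "finite {z\<in>?Z. z < x}" using finite_roots[OF fin, of p] by simp
    have a: "a \<in> ?Z" "a < x" using Max_in[OF f False] by (auto simp: a_def)
    have amax: "z \<le> a" if "z \<in> ?Z" "z < x" for z using Max_ge[OF f] that by (auto simp: a_def)
    obtain a' where a': "R a a'" using sign_corr_left[OF s] by blast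
    have "z' \<le> a'" if "z \<in> ?Z" "R z z'" "z \<le> a" for z z'
      using sign_corr_root_less(1)[OF s a(1) a' that(2)] sign_corr_root_unique[OF s that(1,2), of a'] a' that(3)
      by (cases "z = a") auto
    moreover have "a' < z'" if "z \<in> ?Z" "R z z'" "x < z" for z z'
      using sign_corr_root_less(2)[OF s a(1) a' that(2)] that(3) a(2) by auto
    moreover have "sgn (poly P a) = sgn (poly Q a')"
      using e a(1) a' by (auto simp: extendable_def)
    ultimately show ?thesis using that[of a a'] a amax by blast
  next
    case True
    obtain M where M: "\<And>x. x \<le> M \<Longrightarrow> sgn (poly P x) = (-1) ^ degree P * sgn (lead_coeff P)"
      using sign_at_bot by blast
    obtain N where N: "\<And>x. x \<le> N \<Longrightarrow> sgn (poly Q x) = (-1) ^ degree Q * sgn (lead_coeff Q)"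
      using sign_at_bot by blast
    define a where "a = min M (x - 1)"
    define a' where "a' = Min (insert N ((\<lambda>z. z - 1) ` roots I q))"
    have f: "finite (insert N ((\<lambda>z. z - 1) ` roots I q))" using finite_roots[OF fin, of q] by simp
    have a': "a' \<le> N" "\<And>z'. z' \<in> roots I q \<Longrightarrow> a' < z'"
      using Min_le[OF f] by (auto simp: a'_def) (smt (verit) Min_le f image_eqI insertCI)
    have "sgn (poly P a) = sgn (poly Q a')"
      using M[of a] N[OF a'(1)] e unfolding extendable_def by (metis a_def min.cobounded1)
    moreover have "a' < z'" if "z \<in> ?Z" "R z z'" for z z'
      using a'(2) sign_corr_root[OF s that(2)] that(1) by blast
    moreover have "a < x" by (auto simp: a_def)
    ultimately show ?thesis using that[of a a'] True by blast
  qed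
qed

lemma extendable_upper_end:
  assumes e: "extendable I p q R P Q" and x: "x \<notin> roots I p"
    and a': "\<And>z z'. z \<in> roots I p \<Longrightarrow> R z z' \<Longrightarrow> x < z \<Longrightarrow> a' < z'"
  obtains b b' where "x < b" "a' < b'" "sgn (poly P b) = sgn (poly Q b')"
    "\<And>z z'. z \<in> roots I p \<Longrightarrow> R z z' \<Longrightarrow> (x < z \<longrightarrow> b \<le> z \<and> b' \<le> z') \<and> (z < x \<longrightarrow> z' < b')"
proof -
  let ?Z = "roots I p"
  have s: "sign_corr I p q R" and fin: "finite I" using e by (auto simp: extendable_def)
  show ?thesis
  proof (cases "{z\<in>?Z. x < z} = {}")
    case False
    define b where "b = Min {z\<in>?Z. x < z}"
    have f: "finite {z\<in>?Z. x < z}" using finite_roots[OF fin, of p] by simp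
    have b: "b \<in> ?Z" "x < b" using Min_in[OF f False] by (auto simp: b_def)
    have bmin: "b \<le> z" if "z \<in> ?Z" "x < z" for z using Min_le[OF f] that by (auto simp: b_def)
    obtain b' where b': "R b b'" using sign_corr_left[OF s] by blast
    have "b' \<le> z'" if "z \<in> ?Z" "R z z'" "b \<le> z" for z z'
      using sign_corr_root_less(2)[OF s b(1) b' that(2)] sign_corr_root_unique[OF s that(1,2), of b'] b' that(3)
      by (cases "z = b") auto
    moreover have "z' < b'" if "z \<in> ?Z" "R z z'" "z < x" for z z'
      using sign_corr_root_less(1)[OF s b(1) b' that(2)] that(3) b(2) by auto
    moreover have "sgn (poly P b) = sgn (poly Q b')"
      using e b(1) b' by (auto simp: extendable_def)
    ultimately show ?thesis using that[of b b'] b bmin a'[OF b(1) b'] by blast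
  next
    case True
    obtain M where M: "\<And>x. x \<ge> M \<Longrightarrow> sgn (poly P x) = sgn (lead_coeff P)"
      using sign_at_top by blast
    obtain N where N: "\<And>x. x \<ge> N \<Longrightarrow> sgn (poly Q x) = sgn (lead_coeff Q)"
      using sign_at_top by blast
    define b where "b = max M (x + 1)"
    define b' where "b' = Max (insert N (insert (a' + 1) ((\<lambda>z. z + 1) ` roots I q)))"
    have f: "finite (insert N (insert (a' + 1) ((\<lambda>z. z + 1) ` roots I q)))"
      using finite_roots[OF fin, of q] by simp
    have b'N: "b' \<ge> N" and b'a: "b' \<ge> a' + 1"  using Max_ge[OF f] by (auto simp: b'_def)
    have b'z: "z' < b'" if "z' \<in> roots I q" for z'
      using Max_ge[OF f, of "z' + 1"] that by (auto simp: b'_def)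
    have "sgn (poly P b) = sgn (poly Q b')"
      using M[of b] N[OF b'N] e unfolding extendable_def by (metis b_def max.cobounded1)
    moreover have "z' < b'" if "z \<in> ?Z" "R z z'" for z z'
      using b'z sign_corr_root[OF s that(2)] that(1) by blast
    moreover have "x < b" by (auto simp: b_def)
    moreover have "a' < b'" using b'a by simp
    ultimately show ?thesis using that[of b b'] True by blast
  qed
qed

text \<open>At a root the given partner works. Inside a gap \<open>P\<close> is strictly monotone, its end signs agree with
  those of \<open>Q\<close> in the corresponding gap, and \<open>monotone_sign_transfer\<close> applies.\<close>

lemma extendable_total:
  assumes e: "extendable I p q R P Q"
  shows "\<exists>x'. same_position (roots I p) R x x' \<and> sgn (poly P x) = sgn (poly Q x')"
proof (cases "x \<in> roots I p")
  case True
  have s: "sign_corr I p q R" using e by (auto simp: extendable_def)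
  obtain x' where x': "R x x'" using sign_corr_left[OF s] by blast
  have "(x < z \<longleftrightarrow> x' < z') \<and> (z < x \<longleftrightarrow> z' < x')" if "z \<in> roots I p" "R z z'" for z z'
    using sign_corr_root_less[OF s that x'] sign_corr_root_unique[OF s that, of x'] x'
    by (cases z x rule: linorder_cases) auto
  then show ?thesis using e True x' unfolding same_position_def extendable_def by blast
next
  case False
  obtain a a' where a: "a < x" "sgn (poly P a) = sgn (poly Q a')"
    "\<And>z z'. z \<in> roots I p \<Longrightarrow> R z z' \<Longrightarrow> (z < x \<longrightarrow> z \<le> a \<and> z' \<le> a') \<and> (x < z \<longrightarrow> a' < z')"
    using extendable_lower_end[OF e False] by metis
  obtain b b' where b: "x < b" "a' < b'" "sgn (poly P b) = sgn (poly Q b')"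
    "\<And>z z'. z \<in> roots I p \<Longrightarrow> R z z' \<Longrightarrow> (x < z \<longrightarrow> b \<le> z \<and> b' \<le> z') \<and> (z < x \<longrightarrow> z' < b')"
    using extendable_upper_end[OF e False, of a'] a(3) by metis
  have s: "sign_corr I p q R" using e by (auto simp: extendable_def)
  have "pderiv P \<noteq> 0" using e by (auto simp: extendable_def pderiv_eq_0_iff)
  have "poly (pderiv P) t \<noteq> 0" if "a < t" "t < b" for t
  proof
    assume "poly (pderiv P) t = 0"
    moreover obtain k where "k \<in> I" "p k = pderiv P" using e by (auto simp: extendable_def)
    ultimately have t: "t \<in> roots I p"
      using \<open>pderiv P \<noteq> 0\<close> by (auto simp: roots_def intro!: bexI[of _ k])
    obtain t' where t': "R t t'" using sign_corr_left[OF s] by blast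
    have "t \<noteq> x" using t False by auto
    then show False using a(3)[OF t t'] b(4)[OF t t'] that by linarith
  qed
  from monotone_sign_transfer[OF a(1) b(1,2) this a(2) b(3)]
  obtain x' where x': "a' < x'" "x' < b'" "sgn (poly Q x') = sgn (poly P x)" by blast
  have "(x < z \<longleftrightarrow> x' < z') \<and> (z < x \<longleftrightarrow> z' < x')" if z: "z \<in> roots I p" "R z z'" for z z'
  proof -
    have "z \<noteq> x" using z False by auto
    then show ?thesis using a(3)[OF z] b(4)[OF z] x' by linarith
  qed
  then show ?thesis using x'(3) unfolding same_position_def by auto
qed

lemma poly_const_sign_of_same_ends:
  fixes P :: "real poly"
  assumes "x < z" "sgn (poly P x) = sgn (poly P z)"
    "\<And>t. x \<le> t \<Longrightarrow> t \<le> z \<Longrightarrow> poly (pderiv P) t \<noteq> 0" "x \<le> t" "t \<le> z"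
  shows "sgn (poly P t) = sgn (poly P x)"
proof -
  have *: "sgn (poly P t) = sgn (poly P x)"
    if "\<forall>t. x < t \<longrightarrow> t < z \<longrightarrow> poly (pderiv P) t > 0" "sgn (poly P x) = sgn (poly P z)" for P :: "real poly"
  proof -
    have "poly P x \<le> poly P t" using poly_strict_mono_of_pderiv_pos[of x t P] that assms(4,5)
      by (cases "x = t") auto
    moreover have "poly P t \<le> poly P z" using poly_strict_mono_of_pderiv_pos[of t z P] that assms(4,5)
      by (cases "t = z") auto
    ultimately show ?thesis using that(2) by (auto simp: sgn_if split: if_splits)
  qed
  have nz: "\<And>t. x < t \<Longrightarrow> t < z \<Longrightarrow> poly (pderiv P) t \<noteq> 0" using assms(3) by simp
  from poly_nonvanishing_same_sign[OF nz, of x z] show ?thesis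
  proof
    assume "\<forall>t. x < t \<longrightarrow> t < z \<longrightarrow> poly (pderiv P) t > 0"
    then show ?thesis using * assms(2) by blast
  next
    assume "\<forall>t. x < t \<longrightarrow> t < z \<longrightarrow> poly (pderiv P) t < 0"
    then show ?thesis using *[of "- P"] assms(2) by (simp add: pderiv_minus sgn_minus)
  qed
qed

text \<open>Say both derivatives are positive. Then \<open>sgn P(x) \<le> sgn P(z) = sgn Q(z') \<le> sgn Q(x') = sgn P(x)\<close>.\<close>

lemma reversed_ends_same_sign:
  fixes P Q :: "real poly"
  assumes "x < z" "z' < x'"
    and "sgn (poly P x) = sgn (poly Q x')" "sgn (poly P z) = sgn (poly Q z')"
    and "\<And>t. x \<le> t \<Longrightarrow> t \<le> z \<Longrightarrow> sgn (poly (pderiv P) t) = \<sigma>"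
    and "\<And>t. z' \<le> t \<Longrightarrow> t \<le> x' \<Longrightarrow> sgn (poly (pderiv Q) t) = \<sigma>"
    and "\<sigma> \<noteq> 0"
  shows "sgn (poly P x) = sgn (poly P z)"
proof -
  have *: "sgn (poly P x) = sgn (poly P z)"
    if "sgn (poly P x) = sgn (poly Q x')" "sgn (poly P z) = sgn (poly Q z')"
      "\<And>t. x \<le> t \<Longrightarrow> t \<le> z \<Longrightarrow> poly (pderiv P) t > 0"
      "\<And>t. z' \<le> t \<Longrightarrow> t \<le> x' \<Longrightarrow> poly (pderiv Q) t > 0" for P Q :: "real poly"
  proof -
    have "poly P x < poly P z" "poly Q z' < poly Q x'"
      using poly_strict_mono_of_pderiv_pos assms(1,2) that(3,4) by (meson less_imp_le)+
    then show ?thesis using that(1,2) by (auto simp: sgn_if split: if_splits)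
  qed
  have "\<sigma> = 1 \<or> \<sigma> = -1" using assms(5)[of x] assms(1,7) by (auto simp: sgn_if split: if_splits)
  then show ?thesis
  proof
    assume "\<sigma> = 1"
    then show ?thesis using *[OF assms(3,4)] assms(5,6) by (simp add: sgn_1_pos)
  next
    assume "\<sigma> = -1"
    then show ?thesis using *[of "- P" "- Q"] assms(3-6) by (simp add: sgn_1_neg pderiv_minus sgn_minus)
  qed
qed

text \<open>The inductive heart of quantifier elimination. The new matching consists of the pairs that have the
  same position relative to the roots of the family and at which \<open>P\<close> and \<open>Q\<close> have the same sign.\<close>

lemma sign_corr_extend:
  assumes e: "extendable I p q R P Q"
  shows "\<exists>R'. sign_corr I p q R' \<and> sign_match P Q R'"
proof -
  define M where "M = same_position (roots I p) R"
  define R' where "R' x x' \<longleftrightarrow> M x x' \<and> sgn (poly P x) = sgn (poly Q x')" for x x'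
  have s: "sign_corr I p q R" using e by (auto simp: extendable_def)
  have M_sgn: "sgn (poly (p i) x) = sgn (poly (q i) x')" if "i \<in> I" "M x x'" for i x x'
    using same_position_sgn[OF s that(1)] that(2) by (simp add: M_def)
  have "\<exists>x'. R' x x'" for x
    using extendable_total[OF e] by (simp add: R'_def M_def)
  moreover have "\<exists>x. R' x x'" for x'
  proof -
    obtain x where x: "same_position (roots I q) R\<inverse>\<inverse> x' x" "sgn (poly Q x') = sgn (poly P x)"
      using extendable_total[OF extendable_sym[OF e]] by blast
    have "R\<inverse>\<inverse>\<inverse>\<inverse> = R" by simp
    with same_position_sym[OF sign_corr_sym[OF s] x(1)] x(2) have "R' x x'"
      by (simp add: R'_def M_def)
    then show ?thesis ..
  qed
  ultimately have total: "bi_total R'" by (simp add: bi_total_def)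
  have between: "M t x'" "M x t'"
    if "R' x x'" "R' z z'" "x < z" "z' < x'" "x \<le> t" "t \<le> z" "z' \<le> t'" "t' \<le> x'" for x x' z z' t t'
    using same_position_between[of "roots I p" R x x' z z'] that unfolding R'_def M_def by blast+
  have "sign_match (p i) (q i) R'" if i: "i \<in> I" for i
    unfolding sign_match_def
  proof (intro conjI allI impI ballI)
    fix x x' assume "R' x x'"
    then show "sgn (poly (p i) x) = sgn (poly (q i) x')" using M_sgn[OF i] by (simp add: R'_def)
  next
    fix x x' z z' t assume r: "R' x x'" "R' z z'" "x < z" "z' < x'" and t: "t \<in> {x..z}"
    show "sgn (poly (p i) t) = sgn (poly (p i) x)"
      using M_sgn[OF i, of t x'] M_sgn[OF i, of x x'] between(1)[OF r, of t x'] r t by (simp add: R'_def)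
  next
    fix x x' z z' t assume r: "R' x x'" "R' z z'" "x < z" "z' < x'" and t: "t \<in> {z'..x'}"
    show "sgn (poly (q i) t) = sgn (poly (q i) z')"
      using M_sgn[OF i, of x t] M_sgn[OF i, of x z'] between(2)[OF r, of x t] between(2)[OF r, of x z'] r t
      by simp
  qed
  moreover have "sign_match P Q R'"
  proof -
    obtain k where k: "k \<in> I" "p k = pderiv P" "q k = pderiv Q" using e by (auto simp: extendable_def)
    have "pderiv P \<noteq> 0" "pderiv Q \<noteq> 0" using e by (auto simp: extendable_def pderiv_eq_0_iff)
    show ?thesis
      unfolding sign_match_def
    proof (intro allI impI conjI)
      fix x x' assume "R' x x'"
      then show "sgn (poly P x) = sgn (poly Q x')" by (simp add: R'_def)
    next
      fix x x' z z' assume r: "R' x x'" "R' z z'" "x < z" "z' < x'"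
      define \<sigma> where "\<sigma> = sgn (poly (pderiv P) x)"
      have xx': "\<sigma> = sgn (poly (pderiv Q) x')"
        using M_sgn[OF k(1), of x x'] r(1) k by (simp add: R'_def \<sigma>_def)
      have P: "sgn (poly (pderiv P) t) = \<sigma>" if "x \<le> t" "t \<le> z" for t
        using M_sgn[OF k(1), of t x'] between(1)[OF r that, of x'] r(4) xx' k by simp
      have Q: "sgn (poly (pderiv Q) t) = \<sigma>" if "z' \<le> t" "t \<le> x'" for t
        using M_sgn[OF k(1), of x t] between(2)[OF r _ _ that, of x] r(3) k by (simp add: \<sigma>_def)
      have "\<sigma> \<noteq> 0"
      proof
        assume "\<sigma> = 0"
        then have "poly (pderiv P) t = 0" if "x \<le> t" "t \<le> z" for t
          using P[OF that] by (simp add: sgn_zero_iff)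
        then show False using poly_nonzero_between[OF \<open>pderiv P \<noteq> 0\<close> r(3)] by force
      qed
      have ends: "sgn (poly P x) = sgn (poly Q x')" "sgn (poly P z) = sgn (poly Q z')"
        using r by (auto simp: R'_def)
      note eq = reversed_ends_same_sign[OF r(3,4) ends P Q \<open>\<sigma> \<noteq> 0\<close>]
      have nzP: "poly (pderiv P) t \<noteq> 0" if "x \<le> t" "t \<le> z" for t
        using P[OF that] \<open>\<sigma> \<noteq> 0\<close> by auto
      show "\<forall>t\<in>{x..z}. sgn (poly P t) = sgn (poly P x)"
        by (intro ballI poly_const_sign_of_same_ends[OF r(3) eq nzP]) auto
      have nzQ: "poly (pderiv Q) t \<noteq> 0" if "z' \<le> t" "t \<le> x'" for t
        using Q[OF that] \<open>\<sigma> \<noteq> 0\<close> by auto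
      have "sgn (poly Q z') = sgn (poly Q x')" using eq ends by presburger
      then show "\<forall>t\<in>{z'..x'}. sgn (poly Q t) = sgn (poly Q z')"
        by (intro ballI poly_const_sign_of_same_ends[OF r(4) _ nzQ]) auto
    qed
  qed
  ultimately show ?thesis using total unfolding sign_corr_def by blast
qed

section \<open>Elimination of quantifiers\<close>

type_synonym env = "nat \<Rightarrow> real"

text \<open>Multivariate polynomials are represented by the functions that they define, so that the number of
  variables stays open and the substitution of a value is a function update.\<close>

inductive_set int_poly :: "(env \<Rightarrow> real) set" where
  const: "(\<lambda>e. of_int c) \<in> int_poly"
| var: "(\<lambda>e. e i) \<in> int_poly"
| add: "f \<in> int_poly \<Longrightarrow> g \<in> int_poly \<Longrightarrow> (\<lambda>e. f e + g e) \<in> int_poly"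
| mult: "f \<in> int_poly \<Longrightarrow> g \<in> int_poly \<Longrightarrow> (\<lambda>e. f e * g e) \<in> int_poly"

lemma int_poly_numeral: "(\<lambda>e. numeral c) \<in> int_poly" "(\<lambda>e. 0) \<in> int_poly" "(\<lambda>e. 1) \<in> int_poly"
  using int_poly.const[of "numeral c"] int_poly.const[of 0] int_poly.const[of 1] by simp_all

lemma int_poly_of_nat: "(\<lambda>e. of_nat k) \<in> int_poly"
  using int_poly.const[of "int k"] by simp

lemma int_poly_diff:
  assumes "f \<in> int_poly" "g \<in> int_poly"
  shows "(\<lambda>e. f e - g e) \<in> int_poly"
  using int_poly.add[OF assms(1) int_poly.mult[OF int_poly.const[of "-1"] assms(2)]] by simp

lemma int_poly_power:
  assumes "f \<in> int_poly"
  shows "(\<lambda>e. f e ^ k) \<in> int_poly"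
  by (induction k) (auto intro: int_poly_numeral int_poly.mult assms)

lemma int_poly_sum:
  assumes "\<And>i. i \<in> A \<Longrightarrow> f i \<in> int_poly"
  shows "(\<lambda>e. \<Sum>i\<in>A. f i e) \<in> int_poly"
  using assms
  by (induction A rule: infinite_finite_induct) (auto intro: int_poly_numeral int_poly.add)

lemmas int_poly_intros = int_poly.intros int_poly_numeral int_poly_of_nat int_poly_diff int_poly_power

text \<open>Univariate polynomials whose coefficients are integer polynomials in the parameters. The bound \<open>n\<close> is
  formal: for special values of the parameters the degree may drop.\<close>

definition param_poly :: "nat \<Rightarrow> (env \<Rightarrow> real poly) set" where
  "param_poly n = {P. (\<forall>i. (\<lambda>e. coeff (P e) i) \<in> int_poly) \<and> (\<forall>e. degree (P e) \<le> n)}"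

lemma param_polyI:
  assumes "\<And>i. (\<lambda>e. coeff (P e) i) \<in> int_poly" "\<And>e i. n < i \<Longrightarrow> coeff (P e) i = 0"
  shows "P \<in> param_poly n"
  using assms unfolding param_poly_def by (auto intro: degree_le)

lemma param_poly_coeff: "P \<in> param_poly n \<Longrightarrow> (\<lambda>e. coeff (P e) i) \<in> int_poly"
  and param_poly_coeff_0: "P \<in> param_poly n \<Longrightarrow> n < i \<Longrightarrow> coeff (P e) i = 0"
  unfolding param_poly_def by (auto intro: coeff_eq_0 le_less_trans)

lemma param_poly_mono: "m \<le> n \<Longrightarrow> param_poly m \<subseteq> param_poly n"
  unfolding param_poly_def by (auto intro: order_trans)

lemma param_poly_const: "f \<in> int_poly \<Longrightarrow> (\<lambda>e. [:f e:]) \<in> param_poly n"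
proof (rule param_polyI)
  show "(\<lambda>e. coeff [:f e:] i) \<in> int_poly" if "f \<in> int_poly" for i
    using that by (cases i) (auto intro: int_poly_numeral)
qed (auto simp: coeff_pCons split: nat.split)

lemma param_poly_pderiv: "P \<in> param_poly n \<Longrightarrow> (\<lambda>e. pderiv (P e)) \<in> param_poly (n - 1)"
  by (rule param_polyI)
     (auto simp: coeff_pderiv param_poly_coeff_0 intro!: int_poly.mult int_poly.add int_poly_intros param_poly_coeff)

lemma param_poly_cutoff:
  assumes "P \<in> param_poly n"
  shows "(\<lambda>e. poly_cutoff (Suc j) (P e)) \<in> param_poly j"
proof (rule param_polyI)
  show "(\<lambda>e. coeff (poly_cutoff (Suc j) (P e)) i) \<in> int_poly" for i
    using param_poly_coeff[OF assms] by (cases "i < Suc j") (auto simp: coeff_poly_cutoff int_poly_numeral)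
qed (auto simp: coeff_poly_cutoff)

lemma poly_cutoff_degree:
  fixes p :: "'a :: comm_monoid_add poly"
  shows "(\<And>i. j < i \<Longrightarrow> coeff p i = 0) \<Longrightarrow> poly_cutoff (Suc j) p = p"
  by (rule poly_eqI) (auto simp: coeff_poly_cutoff not_less_eq)

text \<open>Pseudo-division of \<open>P\<close> by \<open>Q\<close>. Each step multiplies by the square of the leading coefficient of \<open>Q\<close>,
  so that the sign of \<open>P\<close> at the roots of \<open>Q\<close> is not disturbed.\<close>

lemma pseudo_remainder:
  assumes "P \<in> param_poly n" "Q \<in> param_poly j" "1 \<le> j"
  shows "\<exists>S\<in>param_poly (j - 1). \<forall>e x. coeff (Q e) j \<noteq> 0 \<longrightarrow> poly (Q e) x = 0 \<longrightarrow>
           sgn (poly (P e) x) = sgn (poly (S e) x)"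
  using assms(1)
proof (induction n arbitrary: P rule: less_induct)
  case (less n)
  show ?case
  proof (cases "n < j")
    case True
    then have "n \<le> j - 1" by simp
    from param_poly_mono[OF this] have "P \<in> param_poly (j - 1)" using less.prems by blast
    then show ?thesis by blast
  next
    case False
    define b where "b e = coeff (Q e) j" for e
    \<comment> \<open>one step of the division: the coefficient of degree \<open>n\<close> cancels\<close>
    define T where "T e = smult ((b e)\<^sup>2) (P e) - smult (b e * coeff (P e) n) (monom 1 (n - j) * Q e)" for e
    have "T \<in> param_poly (n - 1)"
    proof (rule param_polyI)
      have "(\<lambda>e. coeff (monom 1 (n - j) * Q e) i) \<in> int_poly" for i
        using param_poly_coeff[OF assms(2)] by (cases "i < n - j") (auto simp: coeff_monom_mult int_poly_numeral)
      then show "(\<lambda>e. coeff (T e) i) \<in> int_poly" for i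
        unfolding T_def coeff_diff coeff_smult b_def
        by (intro int_poly_intros param_poly_coeff[OF assms(2)] param_poly_coeff[OF less.prems])
      show "coeff (T e) i = 0" if "n - 1 < i" for e i
      proof (cases "i = n")
        case True
        then show ?thesis using False by (simp add: T_def coeff_monom_mult b_def power2_eq_square)
      next
        case f: False
        with that have "n < i" by simp
        moreover from this have "j < i - (n - j)" using False by simp
        ultimately show ?thesis using False
          by (simp add: T_def coeff_monom_mult param_poly_coeff_0[OF less.prems] param_poly_coeff_0[OF assms(2)])
      qed
    qed
    then obtain S where S: "S \<in> param_poly (j - 1)"
      "\<And>e x. coeff (Q e) j \<noteq> 0 \<Longrightarrow> poly (Q e) x = 0 \<Longrightarrow> sgn (poly (T e) x) = sgn (poly (S e) x)"
      using less.IH[of "n - 1" T] False assms(3) by auto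
    have "sgn (poly (P e) x) = sgn (poly (S e) x)" if "coeff (Q e) j \<noteq> 0" "poly (Q e) x = 0" for e x
    proof -
      have "sgn ((b e)\<^sup>2) = 1" using that(1) by (intro sgn_pos) (simp add: b_def)
      then show ?thesis using S(2)[OF that] that(2) by (simp add: T_def sgn_mult)
    qed
    with S(1) show ?thesis by blast
  qed
qed

definition sign_agree :: "(env \<Rightarrow> real) set \<Rightarrow> env \<Rightarrow> env \<Rightarrow> bool" where
  "sign_agree G e e' \<longleftrightarrow> (\<forall>g\<in>G. sgn (g e) = sgn (g e'))"

text \<open>The elements of \<open>Q\<close> serve as their own indices: evaluating all of them at \<open>e\<close> and at \<open>e'\<close> gives the
  two families to be compared.\<close>

definition determined :: "(env \<Rightarrow> real poly) set \<Rightarrow> bool" where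
  "determined Q \<longleftrightarrow> (\<exists>G. finite G \<and> G \<subseteq> int_poly \<and>
     (\<forall>e e'. sign_agree G e e' \<longrightarrow> (\<exists>R. sign_corr Q (\<lambda>P. P e) (\<lambda>P. P e') R)))"

lemma determinedI:
  assumes "finite G" "G \<subseteq> int_poly"
    "\<And>e e'. sign_agree G e e' \<Longrightarrow> \<exists>R. sign_corr Q (\<lambda>P. P e) (\<lambda>P. P e') R"
  shows "determined Q"
  unfolding determined_def by (intro exI[of _ G] conjI allI impI) (rule assms; assumption)+

lemma determined_constants:
  assumes "finite Q" "Q \<subseteq> param_poly 0"
  shows "determined Q"
proof -
  define G where "G = (\<lambda>P e. coeff (P e) 0) ` Q"
  have "sign_corr Q (\<lambda>P. P e) (\<lambda>P. P e') (\<lambda>_ _. True)" if "sign_agree G e e'" for e e'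
  proof -
    have "sign_match (P e) (P e') (\<lambda>_ _. True)" if P: "P \<in> Q" for P
    proof -
      have "degree (P e) = 0" "degree (P e') = 0" using P assms(2) by (auto simp: param_poly_def)
      then obtain a a' where a: "P e = [:a:]" "P e' = [:a':]" by (metis degree_eq_zeroE)
      have "sgn (coeff (P e) 0) = sgn (coeff (P e') 0)"
        using \<open>sign_agree G e e'\<close> P unfolding sign_agree_def G_def by auto
      with a show ?thesis by (simp add: sign_match_def)
    qed
    then show ?thesis by (simp add: sign_corr_def bi_total_def)
  qed
  moreover have "finite G" "G \<subseteq> int_poly"
    using assms param_poly_coeff by (auto simp: G_def)
  ultimately show ?thesis by (intro determinedI[of G]) blast+
qed

lemma sign_corr_coeff:
  assumes "sign_corr I (\<lambda>P. P e) (\<lambda>P. P e') R" "(\<lambda>e. [:coeff (Q e) i:]) \<in> I"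
  shows "sgn (coeff (Q e) i) = sgn (coeff (Q e') i)"
proof -
  obtain x where "R 0 x" using sign_corr_left[OF assms(1)] by blast
  from sign_corr_sgn[OF assms this] show ?thesis by simp
qed

text \<open>The step from a family to one of smaller degree. The set \<open>H\<close> contains the derivative of \<open>P\<close>; the
  coefficients of all polynomials as constants, whose signs reveal the true degrees at a parameter;
  the truncation of \<open>P\<close>, which replaces \<open>P\<close> when its leading coefficient vanishes; and the remainders
  of \<open>P\<close> modulo the truncations of the other polynomials, which give the signs of \<open>P\<close> at their roots.\<close>

lemma determined_insert:
  assumes "finite J" "J \<subseteq> param_poly n" "P \<in> param_poly n" "1 \<le> n"
  shows "\<exists>H. finite H \<and> H \<subseteq> param_poly (n - 1) \<and> (determined (J \<union> H) \<longrightarrow> determined (insert P J))"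
proof -
  define P' where "P' = (\<lambda>e. pderiv (P e))"
  define D where "D = insert P' J"
  have P': "P' \<in> param_poly (n - 1)" unfolding P'_def by (rule param_poly_pderiv[OF assms(3)])
  have D: "D \<subseteq> param_poly n" "finite D"
    using P' param_poly_mono[of "n - 1" n] assms(1,2) by (auto simp: D_def)
  have "\<exists>S\<in>param_poly (j - 1). \<forall>e x. coeff (poly_cutoff (Suc j) (Q e)) j \<noteq> 0 \<longrightarrow> poly (poly_cutoff (Suc j) (Q e)) x = 0 \<longrightarrow>
           sgn (poly (P e) x) = sgn (poly (S e) x)" if "Q \<in> D" "1 \<le> j" for Q j
    using pseudo_remainder[OF assms(3) param_poly_cutoff that(2)] D(1) that(1) by blast
  then obtain rem where rem: "\<And>Q j. Q \<in> D \<Longrightarrow> 1 \<le> j \<Longrightarrow> rem Q j \<in> param_poly (j - 1)"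
    "\<And>Q j e x. Q \<in> D \<Longrightarrow> 1 \<le> j \<Longrightarrow> coeff (poly_cutoff (Suc j) (Q e)) j \<noteq> 0 \<Longrightarrow>
       poly (poly_cutoff (Suc j) (Q e)) x = 0 \<Longrightarrow> sgn (poly (P e) x) = sgn (poly (rem Q j e) x)"
    by metis
  define C where "C = (\<lambda>(Q, i) e. [:coeff (Q e) i:]) ` (insert P D \<times> {..n})"
  define H where "H = {P', \<lambda>e. poly_cutoff n (P e)} \<union> C \<union> (\<lambda>(Q, j). rem Q j) ` (D \<times> {1..n})"
  have "finite H" using D(2) by (simp add: H_def C_def)
  moreover have "H \<subseteq> param_poly (n - 1)"
  proof -
    have "C \<subseteq> param_poly (n - 1)"
      using D(1) assms(3) unfolding C_def by (auto intro!: param_poly_const param_poly_coeff)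
    moreover have "(\<lambda>e. poly_cutoff n (P e)) \<in> param_poly (n - 1)"
      using param_poly_cutoff[OF assms(3), of "n - 1"] assms(4) by simp
    moreover have "rem Q j \<in> param_poly (n - 1)" if "Q \<in> D" "j \<in> {1..n}" for Q j
    proof -
      have "1 \<le> j" "j - 1 \<le> n - 1" using that(2) by auto
      then show ?thesis using rem(1)[OF that(1)] param_poly_mono by blast
    qed
    ultimately show ?thesis using P' by (auto simp: H_def)
  qed
  moreover have "determined (insert P J)" if det: "determined (J \<union> H)"
  proof -
    from det[unfolded determined_def] obtain G where "finite G \<and> G \<subseteq> int_poly \<and>
      (\<forall>e e'. sign_agree G e e' \<longrightarrow> (\<exists>R. sign_corr (J \<union> H) (\<lambda>P. P e) (\<lambda>P. P e') R))"
      by (rule exE)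
    note G = this[THEN conjunct1] this[THEN conjunct2, THEN conjunct1]
      this[THEN conjunct2, THEN conjunct2, rule_format]
    have "\<exists>R. sign_corr (insert P J) (\<lambda>P. P e) (\<lambda>P. P e') R" if ag: "sign_agree G e e'" for e e'
    proof -
      obtain R where R: "sign_corr (J \<union> H) (\<lambda>P. P e) (\<lambda>P. P e') R" using G(3)[OF ag] by blast
      have coeffs: "sgn (coeff (Q e) i) = sgn (coeff (Q e') i)" if "Q \<in> insert P D" for Q i
      proof (cases "i \<le> n")
        case True
        then have "(\<lambda>e. [:coeff (Q e) i:]) \<in> J \<union> H"
          using that unfolding H_def C_def by (intro UnI2 UnI1 image_eqI[of _ _ "(Q, i)"]) auto
        then show ?thesis by (rule sign_corr_coeff[OF R])
      next
        case False
        have "Q \<in> param_poly n" using that D(1) assms(3) by blast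
        then show ?thesis using False by (simp add: param_poly_coeff_0)
      qed
      have RD: "sign_corr D (\<lambda>P. P e) (\<lambda>P. P e') R"
        by (rule sign_corr_subset[OF R]) (auto simp: D_def H_def)
      show ?thesis
      proof (cases "coeff (P e) n = 0")
        case True
        then have "coeff (P e') n = 0" using coeffs[of P n] by (simp add: sgn_zero_iff)
        moreover have cut: "poly_cutoff n (P f) = P f" if z: "coeff (P f) n = 0" for f
        proof (rule poly_eqI)
          fix i
          have "coeff (P f) i = 0" if "\<not> i < n"
            using that z param_poly_coeff_0[OF assms(3), of i f] by (cases "i = n") simp_all
          then show "coeff (poly_cutoff n (P f)) i = coeff (P f) i"
            by (simp add: coeff_poly_cutoff)
        qed
        ultimately have "poly_cutoff n (P e) = P e" "poly_cutoff n (P e') = P e'"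
          using True by blast+
        moreover have "sign_match (poly_cutoff n (P e)) (poly_cutoff n (P e')) R"
        proof -
          have "(\<lambda>e. poly_cutoff n (P e)) \<in> J \<union> H" by (simp add: H_def)
          from bspec[OF R[unfolded sign_corr_def, THEN conjunct2] this] show ?thesis .
        qed
        ultimately have "sign_match (P e) (P e') R" by simp
        moreover have "sign_corr J (\<lambda>P. P e) (\<lambda>P. P e') R"
          by (rule sign_corr_subset[OF R]) auto
        ultimately have "sign_corr (insert P J) (\<lambda>P. P e) (\<lambda>P. P e') R"
          unfolding sign_corr_def by blast
        show ?thesis by (intro exI) fact
      next
        case False
        then have "coeff (P e') n \<noteq> 0" using coeffs[of P n] by (auto simp: sgn_zero_iff)
        with False have deg: "degree (P e) = n" "degree (P e') = n"
          using assms(3) le_degree[of "P e" n] le_degree[of "P e'" n] False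
          by (auto simp: param_poly_def intro!: antisym)
        have "sgn (poly (P e) z) = sgn (poly (P e') z')"
          if z: "z \<in> roots D (\<lambda>P. P e)" and zz': "R z z'" for z z'
        proof -
          obtain Q where Q: "Q \<in> D" "Q e \<noteq> 0" "poly (Q e) z = 0" using z by (auto simp: roots_def)
          define j where "j = degree (Q e)"
          have "j \<noteq> 0"
          proof
            assume "j = 0"
            then obtain a where "Q e = [:a:]" unfolding j_def by (metis degree_eq_zeroE)
            then show False using Q by simp
          qed
          then have j: "1 \<le> j" "j \<le> n" using D(1) Q(1) by (auto simp: j_def param_poly_def)
          have cj: "coeff (Q e) j \<noteq> 0" using Q(2) by (simp add: j_def)
          then have cj': "coeff (Q e') j \<noteq> 0" using coeffs[of Q j] Q(1) by (auto simp: sgn_zero_iff)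
          have c: "poly_cutoff (Suc j) (Q e) = Q e" 
            by (rule poly_cutoff_degree) (auto simp: j_def coeff_eq_0)
          have c': "poly_cutoff (Suc j) (Q e') = Q e'"
          proof (rule poly_cutoff_degree)
            fix i assume "j < i"
            then have "coeff (Q e) i = 0" by (simp add: j_def coeff_eq_0)
            then show "coeff (Q e') i = 0" using coeffs[of Q i] Q(1) by (auto simp: sgn_zero_iff)
          qed
          have "poly (Q e') z' = 0" using sign_corr_sgn[OF RD Q(1) zz'] Q(3) by (auto simp: sgn_zero_iff)
          then have "sgn (poly (P e') z') = sgn (poly (rem Q j e') z')"
            using rem(2)[OF Q(1) j(1), of e' z'] cj' c' by simp
          moreover have "sgn (poly (P e) z) = sgn (poly (rem Q j e) z)"
            using rem(2)[OF Q(1) j(1), of e z] cj c Q(3) by simp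
          moreover have "rem Q j \<in> J \<union> H" using Q(1) j by (auto simp: H_def)
          ultimately show ?thesis using sign_corr_sgn[OF R _ zz'] by metis
        qed
        moreover have "sgn (lead_coeff (P e)) = sgn (lead_coeff (P e'))"
          using deg coeffs[of P n] by simp
        ultimately have "extendable D (\<lambda>P. P e) (\<lambda>P. P e') R (P e) (P e')"
          using RD D(2) deg assms(4) unfolding extendable_def
          by (intro conjI allI impI bexI[of _ P']) (auto simp: P'_def D_def)
        from sign_corr_extend[OF this]
        obtain R' where R': "sign_corr D (\<lambda>P. P e) (\<lambda>P. P e') R'" "sign_match (P e) (P e') R'" by blast
        then have "sign_corr (insert P J) (\<lambda>P. P e) (\<lambda>P. P e') R'"
          unfolding sign_corr_def D_def by blast
        show ?thesis by (intro exI) fact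
      qed
    qed
    with G(1,2) show ?thesis by (rule determinedI)
  qed
  ultimately show ?thesis by blast
qed

text \<open>Induction on the bound for the degree, and for each bound on the number of polynomials that reach it:
  \<open>determined_insert\<close> trades one of them for finitely many of smaller degree.\<close>

theorem determined_param_poly:
  assumes "finite Q" "Q \<subseteq> param_poly n"
  shows "determined Q"
  using assms
proof (induction n arbitrary: Q)
  case 0
  then show ?case by (rule determined_constants)
next
  case (Suc n)
  have "determined (F \<union> H)" if "finite F" "F \<subseteq> param_poly (Suc n)" "finite H" "H \<subseteq> param_poly n" for F H
    using that
  proof (induction F arbitrary: H rule: finite_induct)
    case empty
    then show ?case using Suc.IH by simp
  next
    case (insert P F)
    have "F \<union> H \<subseteq> param_poly (Suc n)" using insert.prems param_poly_mono[of n "Suc n"] by auto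
    then obtain H' where H': "finite H'" "H' \<subseteq> param_poly n" "determined (F \<union> H \<union> H') \<longrightarrow> determined (insert P (F \<union> H))"
      using determined_insert[of "F \<union> H" "Suc n" P] insert by auto
    have "determined (F \<union> (H \<union> H'))" using insert.IH[of "H \<union> H'"] insert.prems H' by auto
    then show ?case using H'(3) by (simp add: Un_assoc)
  qed
  from this[of Q "{}"] Suc.prems show ?case by simp
qed

text \<open>A set is a Boolean combination of polynomial sign conditions exactly if membership depends only on
  the signs of finitely many polynomials. In this form closure under the connectives is immediate.\<close>

definition semialgebraic :: "(env \<Rightarrow> bool) \<Rightarrow> bool" where
  "semialgebraic \<phi> \<longleftrightarrow> (\<exists>F. finite F \<and> F \<subseteq> int_poly \<and> (\<forall>e e'. sign_agree F e e' \<longrightarrow> \<phi> e = \<phi> e'))"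

lemma int_poly_as_param_poly:
  assumes "f \<in> int_poly"
  shows "\<exists>n. \<exists>P\<in>param_poly n. \<forall>e x. f (e(k := x)) = poly (P e) x"
  using assms
proof induction
  case (const c)
  then show ?case
    by (intro exI[of _ 0] bexI[of _ "\<lambda>e. [:of_int c:]"]) (auto intro!: param_poly_const int_poly.const)
next
  case (var i)
  show ?case
  proof (cases "i = k")
    case True
    have "(\<lambda>e. [:0, 1:]) \<in> param_poly 1"
      by (rule param_polyI) (auto simp: coeff_pCons int_poly_numeral split: nat.split)
    with True show ?thesis by (intro exI[of _ 1] bexI[of _ "\<lambda>e. [:0, 1:]"]) auto
  next
    case False
    then show ?thesis
      by (intro exI[of _ 0] bexI[of _ "\<lambda>e. [:e i:]"]) (auto intro!: param_poly_const int_poly.var)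
  qed
next
  case (add f g)
  then obtain m n P Q where "P \<in> param_poly m" "Q \<in> param_poly n"
    and *: "\<And>e x. f (e(k := x)) = poly (P e) x" "\<And>e x. g (e(k := x)) = poly (Q e) x" by blast
  then have "(\<lambda>e. P e + Q e) \<in> param_poly (m + n)"
    by (intro param_polyI) (auto simp: param_poly_coeff_0 intro!: int_poly.add param_poly_coeff)
  then show ?case by (intro exI[of _ "m + n"] bexI[of _ "\<lambda>e. P e + Q e"]) (simp_all only: * poly_add simp_thms)
next
  case (mult f g)
  then obtain m n P Q where P: "P \<in> param_poly m" and Q: "Q \<in> param_poly n"
    and *: "\<And>e x. f (e(k := x)) = poly (P e) x" "\<And>e x. g (e(k := x)) = poly (Q e) x" by blast
  have "(\<lambda>e. P e * Q e) \<in> param_poly (m + n)"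
  proof -
    have "degree (P e * Q e) \<le> m + n" for e
    proof -
      have "degree (P e) \<le> m" "degree (Q e) \<le> n" using P Q by (simp_all add: param_poly_def)
      then show ?thesis using degree_mult_le[of "P e" "Q e"] by linarith
    qed
    moreover have "(\<lambda>e. coeff (P e * Q e) i) \<in> int_poly" for i
      unfolding coeff_mult using param_poly_coeff[OF P] param_poly_coeff[OF Q]
      by (intro int_poly_sum int_poly.mult)
    ultimately show ?thesis by (simp add: param_poly_def)
  qed
  then show ?case by (intro exI[of _ "m + n"] bexI[of _ "\<lambda>e. P e * Q e"]) (simp_all only: * poly_mult simp_thms)
qed

lemma int_polys_as_param_polys:
  assumes "finite F" "F \<subseteq> int_poly"
  shows "\<exists>n P. (\<forall>f\<in>F. P f \<in> param_poly n \<and> (\<forall>e x. f (e(k := x)) = poly (P f e) x))"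
proof -
  have "\<forall>f\<in>F. \<exists>n P. P \<in> param_poly n \<and> (\<forall>e x. f (e(k := x)) = poly (P e) x)"
    using int_poly_as_param_poly assms(2) by (metis subsetD)
  then obtain n P where *: "\<And>f. f \<in> F \<Longrightarrow> P f \<in> param_poly (n f) \<and> (\<forall>e x. f (e(k := x)) = poly (P f e) x)"
    by metis
  have "P f \<in> param_poly (\<Sum>f\<in>F. n f)" if "f \<in> F" for f
    using *[OF that] param_poly_mono[of "n f" "\<Sum>f\<in>F. n f"] member_le_sum[OF that, of n] assms(1) by auto
  then show ?thesis using * by blast
qed

text \<open>The Tarski-Seidenberg theorem. If the families obtained from \<open>e\<close> and \<open>e'\<close> are matched, a witness
  for \<open>e\<close> is turned into a witness for \<open>e'\<close> by passing to a matched point.\<close>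

theorem semialgebraic_projection:
  assumes "semialgebraic \<phi>"
  shows "semialgebraic (\<lambda>e. \<exists>x. \<phi> (e(k := x)))"
proof -
  obtain F where F: "finite F" "F \<subseteq> int_poly" "\<And>e e'. sign_agree F e e' \<Longrightarrow> \<phi> e = \<phi> e'"
    using assms unfolding semialgebraic_def by blast
  obtain n P where P: "\<And>f. f \<in> F \<Longrightarrow> P f \<in> param_poly n" "\<And>f e x. f \<in> F \<Longrightarrow> f (e(k := x)) = poly (P f e) x"
    using int_polys_as_param_polys[OF F(1,2)] by metis
  have "determined (P ` F)" by (rule determined_param_poly[of _ n]) (use F P in auto)
  from this[unfolded determined_def] obtain G where "finite G \<and> G \<subseteq> int_poly \<and>
    (\<forall>e e'. sign_agree G e e' \<longrightarrow> (\<exists>R. sign_corr (P ` F) (\<lambda>P. P e) (\<lambda>P. P e') R))"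
    by (rule exE)
  note G = this[THEN conjunct1] this[THEN conjunct2, THEN conjunct1]
    this[THEN conjunct2, THEN conjunct2, rule_format]
  have "\<exists>x. \<phi> (e'(k := x))" if ag: "sign_agree G e e'" and x: "\<phi> (e(k := x))" for e e' x
  proof -
    obtain R where R: "sign_corr (P ` F) (\<lambda>P. P e) (\<lambda>P. P e') R" using G(3)[OF ag] by blast
    obtain x' where "R x x'" using sign_corr_left[OF R] by blast
    then have "sgn (poly (P f e) x) = sgn (poly (P f e') x')" if "f \<in> F" for f
      using sign_corr_sgn[OF R, of "P f"] that by blast
    then have "sign_agree F (e(k := x)) (e'(k := x'))"
      unfolding sign_agree_def by (intro ballI) (simp only: P(2))
    then show ?thesis using F(3) x by blast
  qed
  moreover have "sign_agree G e' e" if "sign_agree G e e'" for e e'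
    using that unfolding sign_agree_def by simp
  ultimately show ?thesis unfolding semialgebraic_def using G(1,2) by metis
qed

section \<open>An analytic implicit function theorem\<close>

text \<open>The fixed points are the uniform limit of the iterates starting from the constant \<open>z0\<close>, and a
  uniform limit of holomorphic functions is holomorphic.\<close>

lemma fixed_points_holomorphic:
  fixes T :: "complex \<Rightarrow> complex \<Rightarrow> complex"
  assumes "open W" "0 \<le> \<epsilon>"
    and maps: "\<And>w z. w \<in> W \<Longrightarrow> z \<in> cball z0 \<epsilon> \<Longrightarrow> T w z \<in> cball z0 \<epsilon>"
    and contr: "\<And>w z z'. w \<in> W \<Longrightarrow> z \<in> cball z0 \<epsilon> \<Longrightarrow> z' \<in> cball z0 \<epsilon> \<Longrightarrow>
                  dist (T w z) (T w z') \<le> 1/2 * dist z z'"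
    and holo: "\<And>h. h holomorphic_on W \<Longrightarrow> (\<lambda>w. T w (h w)) holomorphic_on W"
  shows "\<exists>b. b holomorphic_on W \<and> (\<forall>w\<in>W. \<forall>z\<in>cball z0 \<epsilon>. T w z = z \<longrightarrow> z = b w)"
proof -
  let ?K = "cball z0 \<epsilon>"
  have "\<exists>!z. z \<in> ?K \<and> T w z = z" if w: "w \<in> W" for w
  proof (rule Banach_fix)
    show "complete ?K" "?K \<noteq> {}" using assms(2) by (auto simp: complete_eq_closed)
    show "T w ` ?K \<subseteq> ?K" using maps[OF w] by blast
    show "dist (T w z) (T w z') \<le> 1/2 * dist z z'" if "z \<in> ?K" "z' \<in> ?K" for z z'
      using contr[OF w that] .
  qed auto
  then obtain b where b: "\<And>w. w \<in> W \<Longrightarrow> b w \<in> ?K \<and> T w (b w) = b w"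
    "\<And>w z. w \<in> W \<Longrightarrow> z \<in> ?K \<Longrightarrow> T w z = z \<Longrightarrow> z = b w" by metis
  define B where "B n = ((\<lambda>h w. T w (h w)) ^^ n) (\<lambda>_. z0)" for n
  have B_holo: "B n holomorphic_on W" for n
    by (induction n) (simp_all add: B_def holo)
  have B: "B n w \<in> ?K \<and> dist (B n w) (b w) \<le> \<epsilon> / 2 ^ n" if "w \<in> W" for n w
  proof (induction n)
    case 0
    then show ?case using b(1)[OF that] assms(2) by (simp add: B_def)
  next
    case (Suc n)
    have eq: "B (Suc n) w = T w (B n w)" by (simp add: B_def)
    have "dist (T w (B n w)) (b w) \<le> 1/2 * dist (B n w) (b w)"
      using contr[OF that, of "B n w" "b w"] Suc b(1)[OF that] by simp
    also have "\<dots> \<le> 1/2 * (\<epsilon> / 2 ^ n)" using Suc by simp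
    finally show ?case using maps[OF that] Suc by (simp add: eq)
  qed
  have lim: "uniform_limit W B b sequentially"
  proof (rule uniform_limitI)
    fix e :: real assume "e > 0"
    have "(\<lambda>n. \<epsilon> / 2 ^ n) \<longlonglongrightarrow> 0" by real_asymp
    then have "\<forall>\<^sub>F n in sequentially. \<epsilon> / 2 ^ n < e" using \<open>e > 0\<close> order_tendstoD(2) by blast
    then show "\<forall>\<^sub>F n in sequentially. \<forall>w\<in>W. dist (B n w) (b w) < e"
      by eventually_elim (use B le_less_trans in blast)
  qed
  have "b holomorphic_on W"
  proof (rule holomorphic_uniform_sequence[OF \<open>open W\<close> B_holo])
    fix w assume "w \<in> W"
    then obtain d where "d > 0" "cball w d \<subseteq> W" using \<open>open W\<close> open_contains_cball by blast
    then show "\<exists>d>0. cball w d \<subseteq> W \<and> uniform_limit (cball w d) B b sequentially"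
      using lim uniform_limit_on_subset by blast
  qed
  with b(2) show ?thesis by blast
qed

text \<open>The implicit function theorem by the simplified Newton iteration \<open>T w z = z - \<Phi> w z / c\<close> with
  \<open>c = \<Phi>' w0 z0\<close>, which is a contraction with constant \<open>1/2\<close> near \<open>(w0, z0)\<close>.\<close>

lemma analytic_branch_complex:
  fixes \<Phi> \<Phi>' :: "complex \<Rightarrow> complex \<Rightarrow> complex"
  assumes deriv: "\<And>w z. (\<Phi> w has_field_derivative \<Phi>' w z) (at z)"
    and cont: "continuous_on UNIV (\<lambda>(w, z). \<Phi>' w z)" "continuous_on UNIV (\<lambda>w. \<Phi> w z0)"
    and holo: "\<And>h W. h holomorphic_on W \<Longrightarrow> (\<lambda>w. \<Phi> w (h w)) holomorphic_on W"
    and zero: "\<Phi> w0 z0 = 0" "\<Phi>' w0 z0 \<noteq> 0"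
  shows "\<exists>b d \<epsilon>. 0 < d \<and> 0 < \<epsilon> \<and> b holomorphic_on ball w0 d \<and>
           (\<forall>w\<in>ball w0 d. \<forall>z\<in>ball z0 \<epsilon>. \<Phi> w z = 0 \<longrightarrow> z = b w)"
proof -
  define c where "c = \<Phi>' w0 z0"
  define T where "T w z = z - \<Phi> w z / c" for w z
  have "c \<noteq> 0" using zero(2) by (simp add: c_def)
  have "continuous (at (w0, z0)) (\<lambda>(w, z). \<Phi>' w z)"
    using cont(1) by (simp add: continuous_on_eq_continuous_at)
  then obtain d1 where d1: "d1 > 0"
    "\<And>w z. dist (w, z) (w0, z0) < d1 \<Longrightarrow> dist (\<Phi>' w z) c < norm c / 2"
    unfolding continuous_at_eps_delta c_def using zero(2)
    by (metis (no_types, lifting) case_prod_conv half_gt_zero zero_less_norm_iff)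
  define \<epsilon> where "\<epsilon> = d1 / 2"
  have "continuous (at w0) (\<lambda>w. \<Phi> w z0)"
    using cont(2) by (simp add: continuous_on_eq_continuous_at)
  moreover have "\<epsilon> * norm c / 2 > 0" using d1(1) \<open>c \<noteq> 0\<close> by (simp add: \<epsilon>_def)
  ultimately obtain d2 where d2: "d2 > 0" "\<And>w. dist w w0 < d2 \<Longrightarrow> norm (\<Phi> w z0) < \<epsilon> * norm c / 2"
    unfolding continuous_at_eps_delta zero(1) dist_0_norm by (metis dist_0_norm dist_commute)
  define d where "d = min d2 (d1 / 2)"
  have "d > 0" "\<epsilon> > 0" using d1(1) d2(1) by (auto simp: d_def \<epsilon>_def)
  have T': "(T w has_field_derivative (1 - \<Phi>' w z / c)) (at z)" for w z
    unfolding T_def by (auto intro!: derivative_eq_intros deriv simp: \<open>c \<noteq> 0\<close>)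
  have T'_bound: "norm (1 - \<Phi>' w z / c) \<le> 1/2" if "w \<in> ball w0 d" "z \<in> cball z0 \<epsilon>" for w z
  proof -
    have "dist (w, z) (w0, z0) \<le> dist w w0 + dist z z0"
      by (simp add: dist_Pair_Pair sqrt_sum_squares_le_sum)
    also have "\<dots> < d1" using that by (auto simp: d_def \<epsilon>_def dist_commute)
    finally have "norm (\<Phi>' w z - c) < norm c / 2" using d1(2) by (simp add: dist_norm)
    moreover have "1 - \<Phi>' w z / c = - (\<Phi>' w z - c) / c" using \<open>c \<noteq> 0\<close> by (simp add: field_simps)
    ultimately show ?thesis using \<open>c \<noteq> 0\<close> by (simp add: norm_divide norm_minus_commute field_simps)
  qed
  have contr: "dist (T w z) (T w z') \<le> 1/2 * dist z z'"
    if "w \<in> ball w0 d" "z \<in> cball z0 \<epsilon>" "z' \<in> cball z0 \<epsilon>" for w z z'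
    unfolding dist_norm
    using field_differentiable_bound[OF convex_cball, of z0 \<epsilon> "T w" "\<lambda>z. 1 - \<Phi>' w z / c" "1/2" z z']
      has_field_derivative_at_within[OF T'] T'_bound that by (auto simp: norm_minus_commute)
  have maps: "T w z \<in> cball z0 \<epsilon>" if "w \<in> ball w0 d" "z \<in> cball z0 \<epsilon>" for w z
  proof -
    have "dist (T w z) z0 \<le> dist (T w z) (T w z0) + dist (T w z0) z0" by (rule dist_triangle)
    also have "dist (T w z) (T w z0) \<le> 1/2 * dist z z0" using contr that \<open>\<epsilon> > 0\<close> by auto
    also have "dist (T w z0) z0 \<le> \<epsilon> / 2"
    proof -
      have "norm (\<Phi> w z0) < \<epsilon> * norm c / 2" using d2(2)[of w] that(1) by (simp add: d_def dist_commute)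
      then have "norm (\<Phi> w z0) / norm c < \<epsilon> / 2" using \<open>c \<noteq> 0\<close> by (simp add: field_simps)
      then show ?thesis by (simp add: T_def dist_norm norm_divide)
    qed
    also have "1/2 * dist z z0 \<le> \<epsilon> / 2" using that(2) by (simp add: dist_commute)
    finally show ?thesis by (simp add: dist_commute)
  qed
  have "\<exists>b. b holomorphic_on ball w0 d \<and> (\<forall>w\<in>ball w0 d. \<forall>z\<in>cball z0 \<epsilon>. T w z = z \<longrightarrow> z = b w)"
  proof (rule fixed_points_holomorphic[OF open_ball _ maps contr])
    show "0 \<le> \<epsilon>" using \<open>\<epsilon> > 0\<close> by simp
    show "(\<lambda>w. T w (h w)) holomorphic_on ball w0 d" if "h holomorphic_on ball w0 d" for h
      unfolding T_def using that holo[OF that] \<open>c \<noteq> 0\<close> by (intro holomorphic_intros) auto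
  qed auto
  then obtain b where "b holomorphic_on ball w0 d"
    "\<And>w z. w \<in> ball w0 d \<Longrightarrow> z \<in> cball z0 \<epsilon> \<Longrightarrow> T w z = z \<Longrightarrow> z = b w" by blast
  then show ?thesis using \<open>d > 0\<close> \<open>\<epsilon> > 0\<close>
    by (intro exI[of _ b] exI[of _ d] exI[of _ \<epsilon>]) (auto simp: T_def)
qed

lemma poly_of_real_map_poly:
  "poly (map_poly complex_of_real p) (of_real x) = of_real (poly p x)"
  by (induction p) (simp_all add: map_poly_pCons)

text \<open>The complex branch is expanded into a power series at \<open>x0\<close>; a real solution is equal to its real
  part, so the real parts of the coefficients give the real series.\<close>

lemma analytic_branch_real:
  fixes c :: "nat \<Rightarrow> real poly"
  assumes zero: "(\<Sum>i\<le>n. poly (c i) x0 * y0 ^ i) = 0"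
    and simple: "(\<Sum>i\<le>n. poly (c i) x0 * (of_nat i * y0 ^ (i - 1))) \<noteq> 0"
  shows "\<exists>a d \<epsilon>. 0 < d \<and> 0 < \<epsilon> \<and> (\<forall>x. \<bar>x - x0\<bar> < d \<longrightarrow> summable (\<lambda>k. a k * (x - x0) ^ k) \<and>
           (\<forall>y. \<bar>y - y0\<bar> < \<epsilon> \<longrightarrow> (\<Sum>i\<le>n. poly (c i) x * y ^ i) = 0 \<longrightarrow> y = (\<Sum>k. a k * (x - x0) ^ k)))"
proof -
  define C where "C i = map_poly complex_of_real (c i)" for i
  define \<Phi> where "\<Phi> w z = (\<Sum>i\<le>n. poly (C i) w * z ^ i)" for w z
  define \<Phi>' where "\<Phi>' w z = (\<Sum>i\<le>n. poly (C i) w * (of_nat i * z ^ (i - 1)))" for w z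
  have C: "poly (C i) (of_real x) = of_real (poly (c i) x)" for i x
    by (simp add: C_def poly_of_real_map_poly)
  have \<Phi>: "\<Phi> (of_real x) (of_real y) = of_real (\<Sum>i\<le>n. poly (c i) x * y ^ i)" for x y
    by (simp add: \<Phi>_def C)
  have \<Phi>': "\<Phi>' (of_real x) (of_real y) = of_real (\<Sum>i\<le>n. poly (c i) x * (of_nat i * y ^ (i - 1)))" for x y
    by (simp add: \<Phi>'_def C)
  have "\<exists>b d \<epsilon>. 0 < d \<and> 0 < \<epsilon> \<and> b holomorphic_on ball (of_real x0) d \<and>
           (\<forall>w\<in>ball (of_real x0) d. \<forall>z\<in>ball (of_real y0) \<epsilon>. \<Phi> w z = 0 \<longrightarrow> z = b w)"
  proof (rule analytic_branch_complex[where \<Phi>' = \<Phi>'])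
    show "(\<Phi> w has_field_derivative \<Phi>' w z) (at z)" for w z
      unfolding \<Phi>_def \<Phi>'_def by (auto intro!: derivative_eq_intros sum.cong)
    show "continuous_on UNIV (\<lambda>(w, z). \<Phi>' w z)"
      unfolding \<Phi>'_def case_prod_beta by (intro continuous_intros)
    show "continuous_on UNIV (\<lambda>w. \<Phi> w (of_real y0))"
      unfolding \<Phi>_def by (intro continuous_intros)
    show "(\<lambda>w. \<Phi> w (h w)) holomorphic_on W" if "h holomorphic_on W" for h W
      unfolding \<Phi>_def using that by (intro holomorphic_intros)
    show "\<Phi> (of_real x0) (of_real y0) = 0" "\<Phi>' (of_real x0) (of_real y0) \<noteq> 0"
      using zero simple unfolding \<Phi> \<Phi>' of_real_eq_0_iff by auto
  qed
  then obtain b d \<epsilon> where b: "0 < d" "0 < \<epsilon>" "b holomorphic_on ball (of_real x0) d"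
    "\<And>w z. w \<in> ball (of_real x0) d \<Longrightarrow> z \<in> ball (of_real y0) \<epsilon> \<Longrightarrow> \<Phi> w z = 0 \<Longrightarrow> z = b w" by blast
  define A where "A k = (deriv ^^ k) b (of_real x0) / fact k" for k
  have ball: "complex_of_real x \<in> ball (of_real u) r" if "\<bar>x - u\<bar> < r" for x u r
    using that by (simp add: dist_norm abs_minus_commute flip: of_real_diff)
  have sums: "(\<lambda>k. Re (A k) * (x - x0) ^ k) sums Re (b (of_real x))" if "\<bar>x - x0\<bar> < d" for x
  proof -
    have "(\<lambda>k. A k * (of_real x - of_real x0) ^ k) sums b (of_real x)"
      unfolding A_def by (rule holomorphic_power_series[OF b(3) ball[OF that]])
    from sums_Re[OF this] show ?thesis by (simp flip: of_real_diff of_real_power)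
  qed
  have "y = (\<Sum>k. Re (A k) * (x - x0) ^ k)"
    if x: "\<bar>x - x0\<bar> < d" and y: "\<bar>y - y0\<bar> < \<epsilon>" and "(\<Sum>i\<le>n. poly (c i) x * y ^ i) = 0" for x y
  proof -
    have "\<Phi> (of_real x) (of_real y) = 0" unfolding \<Phi> using that(3) by simp
    then have "complex_of_real y = b (of_real x)" by (rule b(4)[OF ball[OF x] ball[OF y]])
    then have "y = Re (b (of_real x))" by (metis Re_complex_of_real)
    then show ?thesis using sums_unique[OF sums[OF x]] by simp
  qed
  then show ?thesis
    using b(1,2) sums_summable[OF sums]
    by (intro exI[of _ "\<lambda>k. Re (A k)"] exI[of _ d] exI[of _ \<epsilon>] conjI allI impI) blast+
qed

section \<open>Functions with semialgebraic graph\<close>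

text \<open>On a finite ordered set an increasing map is fixed by its image: consider the least point where
  \<open>f\<close> and \<open>g\<close> differ.\<close>

lemma strict_mono_on_same_image:
  fixes f g :: "real \<Rightarrow> real"
  assumes "finite A" "strict_mono_on A f" "strict_mono_on A g" "g ` A \<subseteq> f ` A" "a \<in> A"
  shows "f a = g a"
proof (rule ccontr)
  assume "f a \<noteq> g a"
  have "g ` A = f ` A"
    using assms(1,4) card_image[OF strict_mono_on_imp_inj_on[OF assms(2)]]
      card_image[OF strict_mono_on_imp_inj_on[OF assms(3)]]
    by (intro card_subset_eq) auto
  define S where "S = {a\<in>A. f a \<noteq> g a}"
  define m where "m = Min S"
  have S: "finite S" "S \<noteq> {}" using assms(1,5) \<open>f a \<noteq> g a\<close> by (auto simp: S_def)
  have m: "m \<in> A" "f m \<noteq> g m" using Min_in[OF S] by (auto simp: m_def S_def)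
  have less: "f c = g c" if "c \<in> A" "c < m" for c
    using Min_le[OF S(1), of c] that unfolding m_def S_def by fastforce
  have *: False if hk: "strict_mono_on A h" "strict_mono_on A k" "h ` A = k ` A" "h m < k m"
    "\<And>c. c \<in> A \<Longrightarrow> c < m \<Longrightarrow> h c = k c" for h k :: "real \<Rightarrow> real"
  proof -
    obtain c where c: "c \<in> A" "k c = h m" using hk(3) m(1) by (metis imageE imageI)
    then have "c < m" using hk(2,4) m(1) by (metis strict_mono_on_less)
    then show False
      using hk(5)[OF c(1)] c hk(1) m(1) by (metis less_irrefl strict_mono_onD)
  qed
  show False
    using *[of f g] *[of g f] assms(2,3) \<open>g ` A = f ` A\<close> m(2) less by (metis linorder_neqE_linordered_idom)
qed

lemma finite_reals_separated:
  fixes A :: "real set"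
  assumes "finite A" "0 < \<epsilon>"
  shows "\<exists>\<delta>>0. \<delta> \<le> \<epsilon> \<and> (\<forall>a\<in>A. \<forall>b\<in>A. a < b \<longrightarrow> a + \<delta> \<le> b - \<delta>)"
proof -
  define D where "D = insert \<epsilon> ((\<lambda>(a, b). (b - a) / 2) ` {(a, b) \<in> A \<times> A. a < b})"
  have "finite {(a, b) \<in> A \<times> A. a < b}" by (rule finite_subset[of _ "A \<times> A"]) (use assms in auto)
  then have fin: "finite D" by (simp add: D_def)
  have "Min D > 0" using fin assms(2) by (subst Min_gr_iff) (auto simp: D_def)
  moreover have "Min D \<le> \<epsilon>" using fin by (intro Min_le) (auto simp: D_def)
  moreover have "a + Min D \<le> b - Min D" if "a \<in> A" "b \<in> A" "a < b" for a b
  proof -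
    have "(b - a) / 2 \<in> D" unfolding D_def using that by force
    then have "Min D \<le> (b - a) / 2" using fin by (rule Min_le[rotated])
    then show ?thesis by (simp add: field_simps)
  qed
  ultimately show ?thesis by blast
qed

lemma simple_root_sign_change:
  fixes p :: "real poly"
  assumes "poly p z = 0" "poly (pderiv p) z \<noteq> 0" "0 < \<delta>"
  shows "\<exists>u v. z - \<delta> < u \<and> u < z \<and> z < v \<and> v < z + \<delta> \<and> poly p u * poly p v < 0"
proof -
  have *: "\<exists>u v. z - \<delta> < u \<and> u < z \<and> z < v \<and> v < z + \<delta> \<and> poly p u * poly p v < 0"
    if p: "poly p z = 0" "poly (pderiv p) z > 0" for p
  proof -
    obtain d1 where d1: "d1 > 0" "\<And>h. h > 0 \<Longrightarrow> h < d1 \<Longrightarrow> poly p z < poly p (z + h)"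
      using DERIV_pos_inc_right[OF poly_DERIV p(2)] by blast
    obtain d2 where d2: "d2 > 0" "\<And>h. h > 0 \<Longrightarrow> h < d2 \<Longrightarrow> poly p (z - h) < poly p z"
      using DERIV_pos_inc_left[OF poly_DERIV p(2)] by blast
    define h where "h = min \<delta> (min d1 d2) / 2"
    have h: "0 < h" "h < \<delta>" "h < d1" "h < d2" using assms(3) d1(1) d2(1) by (auto simp: h_def)
    have "poly p (z - h) < 0" "0 < poly p (z + h)" using d1(2)[of h] d2(2)[of h] h p(1) by auto
    then have "poly p (z - h) * poly p (z + h) < 0" by (rule mult_neg_pos)
    then show ?thesis using h by (intro exI[of _ "z - h"] exI[of _ "z + h"]) auto
  qed
  show ?thesis
  proof (cases "poly (pderiv p) z > 0")
    case True
    then show ?thesis using * assms(1) by blast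
  next
    case False
    then show ?thesis using *[of "- p"] assms by (simp add: pderiv_minus)
  qed
qed

lemma higher_pderiv_eq_0:
  fixes p :: "real poly"
  shows "degree p < k \<Longrightarrow> (pderiv ^^ k) p = 0"
proof (induction k arbitrary: p)
  case (Suc k)
  show ?case
  proof (cases "degree p = 0")
    case True
    then have "pderiv p = 0" by (simp add: pderiv_eq_0_iff)
    moreover have "(pderiv ^^ k) 0 = (0 :: real poly)" by (induction k) auto
    ultimately show ?thesis by (simp add: funpow_swap1)
  next
    case False
    then have "(pderiv ^^ k) (pderiv p) = 0" using Suc by (intro Suc.IH) (simp add: degree_pderiv)
    then show ?thesis by (simp add: funpow_swap1)
  qed
qed simp

lemma higher_pderiv_nonzero:
  fixes p :: "real poly"
  assumes "p \<noteq> 0"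
  shows "\<exists>k. poly ((pderiv ^^ k) p) z \<noteq> 0"
  using assms
proof (induction "degree p" arbitrary: p)
  case 0
  then obtain a where "p = [:a:]" by (metis degree_eq_zeroE)
  with 0 show ?case by (intro exI[of _ 0]) auto
next
  case (Suc d)
  then have "pderiv p \<noteq> 0" "d = degree (pderiv p)" by (auto simp: pderiv_eq_0_iff degree_pderiv)
  then obtain k where "poly ((pderiv ^^ k) (pderiv p)) z \<noteq> 0" using Suc.hyps(1) by blast
  then show ?case by (intro exI[of _ "Suc k"]) (simp add: funpow_swap1)
qed

text \<open>Differentiate until just before the value at \<open>z\<close> becomes nonzero.\<close>

lemma higher_pderiv_simple_root:
  fixes p :: "real poly"
  assumes "(pderiv ^^ k) p \<noteq> 0" "poly ((pderiv ^^ k) p) z = 0"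
  shows "\<exists>m < degree p. poly ((pderiv ^^ m) p) z = 0 \<and> poly (pderiv ((pderiv ^^ m) p)) z \<noteq> 0"
proof -
  define j where "j = (LEAST j. poly ((pderiv ^^ j) ((pderiv ^^ k) p)) z \<noteq> 0)"
  have j: "poly ((pderiv ^^ j) ((pderiv ^^ k) p)) z \<noteq> 0"
    unfolding j_def by (rule LeastI_ex[OF higher_pderiv_nonzero[OF assms(1)]])
  moreover have "j \<noteq> 0" using j assms(2) by (intro notI) simp
  then obtain i where i: "j = Suc i" by (metis not0_implies_Suc)
  have "poly ((pderiv ^^ i) ((pderiv ^^ k) p)) z = 0"
    using not_less_Least[of i "\<lambda>j. poly ((pderiv ^^ j) ((pderiv ^^ k) p)) z \<noteq> 0"] i by (simp add: j_def)
  then have 1: "poly ((pderiv ^^ (i + k)) p) z = 0" by (simp add: funpow_add)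
  have 2: "poly ((pderiv ^^ Suc (i + k)) p) z \<noteq> 0" using j i by (simp add: funpow_add)
  then have "\<not> degree p < Suc (i + k)" using higher_pderiv_eq_0[of p "Suc (i + k)"] by fastforce
  with 1 2 show ?thesis by (intro exI[of _ "i + k"]) simp
qed

text \<open>For a relation between the variables \<open>0\<close> and \<open>1\<close>, the variable \<open>0\<close> is the parameter and the
  variable \<open>1\<close> becomes the unknown of the univariate polynomials.\<close>

definition base_env :: "real \<Rightarrow> env" where
  "base_env x = (\<lambda>_. 0)(0 := x)"

lemma base_env_simps [simp]: "base_env x 0 = x" "i \<noteq> 0 \<Longrightarrow> base_env x i = 0"
  by (simp_all add: base_env_def)

lemma int_poly_univariate:
  assumes "f \<in> int_poly"
  shows "\<exists>p. (\<forall>i. coeff p i \<in> \<int>) \<and> (\<forall>x. f (base_env x) = poly p x)"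
  using assms
proof induction
  case (const c)
  then show ?case by (intro exI[of _ "[:of_int c:]"]) (auto simp: coeff_pCons split: nat.split)
next
  case (var i)
  show ?case
  proof (cases "i = 0")
    case True
    then show ?thesis by (intro exI[of _ "[:0, 1:]"]) (auto simp: coeff_pCons split: nat.split)
  next
    case False
    then show ?thesis by (intro exI[of _ 0]) auto
  qed
next
  case (add f g)
  then obtain p q where "\<And>i. coeff p i \<in> \<int>" "\<And>i. coeff q i \<in> \<int>"
    "\<And>x. f (base_env x) = poly p x" "\<And>x. g (base_env x) = poly q x" by blast
  then show ?case by (intro exI[of _ "p + q"]) simp
next
  case (mult f g)
  then obtain p q where "\<And>i. coeff p i \<in> \<int>" "\<And>i. coeff q i \<in> \<int>"
    "\<And>x. f (base_env x) = poly p x" "\<And>x. g (base_env x) = poly q x" by blast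
  then show ?case by (intro exI[of _ "p * q"]) (simp add: coeff_mult Ints_sum)
qed

lemma param_poly_expand:
  assumes "P \<in> param_poly n"
  shows "\<exists>c :: nat \<Rightarrow> real poly. \<forall>x y. poly (P (base_env x)) y = (\<Sum>i\<le>n. poly (c i) x * y ^ i)"
proof -
  have "\<forall>i. \<exists>p. \<forall>x. coeff (P (base_env x)) i = poly p x"
    using int_poly_univariate[OF param_poly_coeff[OF assms]] by metis
  then obtain c where c: "\<And>i x. coeff (P (base_env x)) i = poly (c i) x" by metis
  have "poly (P (base_env x)) y = (\<Sum>i\<le>n. poly (c i) x * y ^ i)" for x y
  proof -
    have "degree (P (base_env x)) \<le> n" using assms by (simp add: param_poly_def)
    then have "poly (P (base_env x)) y = (\<Sum>i\<le>n. coeff (P (base_env x)) i * y ^ i)"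
      unfolding poly_altdef by (intro sum.mono_neutral_left) (auto simp: coeff_eq_0)
    then show ?thesis by (simp add: c)
  qed
  then show ?thesis by blast
qed

lemma param_poly_isCont:
  assumes "P \<in> param_poly n"
  shows "isCont (\<lambda>x. poly (P (base_env x)) y) x0"
proof -
  obtain c where "\<And>x y. poly (P (base_env x)) y = (\<Sum>i\<le>n. poly (c i) x * y ^ i)"
    using param_poly_expand[OF assms] by blast
  then show ?thesis by simp
qed

lemma eventually_sgn_poly:
  fixes p :: "real poly"
  assumes "p = 0 \<or> poly p x0 \<noteq> 0"
  shows "\<forall>\<^sub>F x in nhds x0. sgn (poly p x0) = sgn (poly p x)"
proof (cases "p = 0")
  case False
  then obtain d where "d > 0" "\<And>x. \<bar>x - x0\<bar> < d \<Longrightarrow> sgn (poly p x) = sgn (poly p x0)"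
    using poly_same_sign_near[of p x0 "sgn (poly p x0)"] assms by (auto simp: sgn_zero_iff)
  then show ?thesis unfolding eventually_nhds_metric dist_real_def by (metis)
qed simp

text \<open>A simple root makes its polynomial change sign in an arbitrarily small interval, and this persists
  for nearby \<open>x\<close>. This yields a strictly increasing map from the roots over \<open>x0\<close> to nearby roots over
  \<open>x\<close>. The matching is another such map and is onto, so the two maps are equal.\<close>

lemma corresponding_roots_near:
  assumes fin: "finite Q" and Q: "Q \<subseteq> param_poly n" and "0 < \<epsilon>"
    and simple: "\<And>z. z \<in> roots Q (\<lambda>P. P (base_env x0)) \<Longrightarrow>
       \<exists>P\<in>Q. poly (P (base_env x0)) z = 0 \<and> poly (pderiv (P (base_env x0))) z \<noteq> 0"
  shows "\<forall>\<^sub>F x in nhds x0. \<forall>R z z'. sign_corr Q (\<lambda>P. P (base_env x0)) (\<lambda>P. P (base_env x)) R \<longrightarrow>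
           z \<in> roots Q (\<lambda>P. P (base_env x0)) \<longrightarrow> R z z' \<longrightarrow> \<bar>z' - z\<bar> < \<epsilon>"
proof -
  define Z where "Z = roots Q (\<lambda>P. P (base_env x0))"
  have finZ: "finite Z" unfolding Z_def by (rule finite_roots[OF fin])
  \<comment> \<open>intervals of radius \<open>\<delta>\<close> around distinct roots are disjoint and ordered like the roots\<close>
  obtain \<delta> where \<delta>: "\<delta> > 0" "\<delta> \<le> \<epsilon>" "\<And>a b. a \<in> Z \<Longrightarrow> b \<in> Z \<Longrightarrow> a < b \<Longrightarrow> a + \<delta> \<le> b - \<delta>"
    using finite_reals_separated[OF finZ \<open>0 < \<epsilon>\<close>] by blast
  have "\<exists>P u v. P \<in> Q \<and> z - \<delta> < u \<and> u < z \<and> z < v \<and> v < z + \<delta> \<and>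
      poly (P (base_env x0)) u * poly (P (base_env x0)) v < 0" if "z \<in> Z" for z
    using simple[of z] that simple_root_sign_change[OF _ _ \<delta>(1)] unfolding Z_def by metis
  then obtain P u v where P: "\<And>z. z \<in> Z \<Longrightarrow> P z \<in> Q"
    and uv: "\<And>z. z \<in> Z \<Longrightarrow> z - \<delta> < u z \<and> u z < z \<and> z < v z \<and> v z < z + \<delta>"
    and neg: "\<And>z. z \<in> Z \<Longrightarrow> poly (P z (base_env x0)) (u z) * poly (P z (base_env x0)) (v z) < 0"
    by metis
  have "\<forall>\<^sub>F x in nhds x0. poly (P z (base_env x)) (u z) * poly (P z (base_env x)) (v z) < 0" if z: "z \<in> Z" for z
  proof -
    have "P z \<in> param_poly n" using P[OF z] Q by blast
    define g where "g x = poly (P z (base_env x)) (u z) * poly (P z (base_env x)) (v z)" for x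
    have "isCont g x0"
      unfolding g_def using \<open>P z \<in> param_poly n\<close> by (intro isCont_mult param_poly_isCont)
    then have "(g \<longlongrightarrow> g x0) (nhds x0)" by (simp add: isCont_def tendsto_at_iff_tendsto_nhds)
    moreover have "g x0 < 0" using neg[OF z] by (simp add: g_def)
    ultimately have "\<forall>\<^sub>F x in nhds x0. g x < 0" by (rule order_tendstoD(2))
    then show ?thesis by (simp only: g_def)
  qed
  then have "\<forall>\<^sub>F x in nhds x0. \<forall>z\<in>Z. poly (P z (base_env x)) (u z) * poly (P z (base_env x)) (v z) < 0"
    by (intro eventually_ball_finite finZ) blast
  then show ?thesis
  proof eventually_elim
    case (elim x)
    show ?case
    proof (intro allI impI)
      fix R z z'
      assume R: "sign_corr Q (\<lambda>P. P (base_env x0)) (\<lambda>P. P (base_env x)) R"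
        and z: "z \<in> roots Q (\<lambda>P. P (base_env x0))" and zz': "R z z'"
      define Z' where "Z' = roots Q (\<lambda>P. P (base_env x))"
      have "\<exists>b. u z < b \<and> b < v z \<and> b \<in> Z'" if zZ: "z \<in> Z" for z
      proof -
        have n: "poly (P z (base_env x)) (u z) * poly (P z (base_env x)) (v z) < 0" using elim zZ by blast
        then obtain b where b: "u z < b" "b < v z" "poly (P z (base_env x)) b = 0"
          using poly_IVT[of "u z" "v z" "P z (base_env x)"] uv[OF zZ] by auto
        moreover have "P z (base_env x) \<noteq> 0" using n by auto
        ultimately show ?thesis using P[OF zZ] unfolding Z'_def roots_def by blast
      qed
      then obtain b where b: "\<And>z. z \<in> Z \<Longrightarrow> u z < b z \<and> b z < v z \<and> b z \<in> Z'" by metis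
      obtain f where f: "\<And>z. R z (f z)" using sign_corr_left[OF R] by metis
      have "strict_mono_on Z b"
      proof (rule strict_mono_onI)
        fix r s assume "r \<in> Z" "s \<in> Z" "r < s"
        then show "b r < b s" using b[of r] b[of s] uv[of r] uv[of s] \<delta>(3)[of r s] by linarith
      qed
      moreover have "strict_mono_on Z f"
        using sign_corr_root_less(1)[OF R _ f f] unfolding Z_def by (intro strict_mono_onI) blast
      moreover have "Z' \<subseteq> f ` Z"
      proof
        fix w assume w: "w \<in> Z'"
        obtain y where y: "R y w" using sign_corr_right[OF R] by blast
        then have "y \<in> Z" using sign_corr_root[OF R y] w by (simp add: Z_def Z'_def)
        moreover from this have "f y = w" using sign_corr_root_unique[OF R _ f y] by (simp add: Z_def)
        ultimately show "w \<in> f ` Z" by blast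
      qed
      moreover have "b ` Z \<subseteq> Z'" using b by blast
      moreover have "z \<in> Z" using z by (simp add: Z_def)
      ultimately have "f z = b z" using finZ by (intro strict_mono_on_same_image[of Z]) auto
      moreover have "z' = f z" by (rule sign_corr_root_unique[OF R z zz' f])
      ultimately show "\<bar>z' - z\<bar> < \<epsilon>" using b[OF \<open>z \<in> Z\<close>] uv[OF \<open>z \<in> Z\<close>] \<delta>(2) by linarith
    qed
  qed
qed

text \<open>Away from \<open>E\<close> the matching over nearby points preserves the solutions of \<open>G\<close>. The closure \<open>Q\<close> of the
  family under derivatives makes every root a simple root of some member. Over \<open>x0\<close> the solution is
  isolated, hence a root, and so it continues to the analytic branch of a simple root.\<close>

theorem semialgebraic_function_analytic:
  assumes semialg: "semialgebraic (\<lambda>e. G (e 0) (e 1))"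
    and unique: "\<forall>x y y'. G x y \<longrightarrow> G x y' \<longrightarrow> y = y'"
  shows "\<exists>E. finite E \<and> (\<forall>x\<in>E. algebraic x) \<and> (\<forall>x0. x0 \<notin> E \<longrightarrow>
           (\<exists>d>0. \<forall>x. \<bar>x - x0\<bar> < d \<longrightarrow> \<not> (\<exists>y. G x y)) \<or>
           (\<exists>a. \<exists>d>0. \<forall>x. \<bar>x - x0\<bar> < d \<longrightarrow>
              summable (\<lambda>k. a k * (x - x0) ^ k) \<and> G x (\<Sum>k. a k * (x - x0) ^ k)))"
proof -
  obtain F where F: "finite F" "F \<subseteq> int_poly"
    and F_sgn: "\<And>e e'. sign_agree F e e' \<Longrightarrow> G (e 0) (e 1) = G (e' 0) (e' 1)"
    using semialg unfolding semialgebraic_def by blast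
  obtain n P where P: "\<And>f. f \<in> F \<Longrightarrow> P f \<in> param_poly n"
    and Pf: "\<And>f e y. f \<in> F \<Longrightarrow> f (e(1 := y)) = poly (P f e) y"
    using int_polys_as_param_polys[OF F, of 1] by metis
  define D where "D f k = (\<lambda>e. (pderiv ^^ k) (P f e))" for f k
  define Q where "Q = (\<lambda>(f, k). D f k) ` (F \<times> {..n})"
  have D_in: "D f k \<in> param_poly n" if f: "f \<in> F" for f k
  proof (induction k)
    case 0
    then show ?case using P[OF f] by (simp add: D_def)
  next
    case (Suc k)
    then have "(\<lambda>e. pderiv (D f k e)) \<in> param_poly n"
      using param_poly_pderiv param_poly_mono[of "n - 1" n] by (meson diff_le_self subsetD)
    then show ?case by (simp add: D_def)
  qed
  have Q: "finite Q" "Q \<subseteq> param_poly n" using F(1) D_in by (auto simp: Q_def)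
  have "determined Q" by (rule determined_param_poly[OF Q])
  from this[unfolded determined_def] obtain H where "finite H \<and> H \<subseteq> int_poly \<and>
    (\<forall>e e'. sign_agree H e e' \<longrightarrow> (\<exists>R. sign_corr Q (\<lambda>P. P e) (\<lambda>P. P e') R))"
    by (rule exE)
  note H = this[THEN conjunct1] this[THEN conjunct2, THEN conjunct1]
    this[THEN conjunct2, THEN conjunct2, rule_format]
  have "\<forall>h\<in>H. \<exists>p. (\<forall>i. coeff p i \<in> \<int>) \<and> (\<forall>x. h (base_env x) = poly p x)"
    using int_poly_univariate H(2) by blast
  then obtain hp :: "(env \<Rightarrow> real) \<Rightarrow> real poly" where hp: "\<And>h i. h \<in> H \<Longrightarrow> coeff (hp h) i \<in> \<int>"
    "\<And>h x. h \<in> H \<Longrightarrow> h (base_env x) = poly (hp h) x" by metis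
  define E where "E = roots H hp"
  have "finite E" unfolding E_def by (rule finite_roots[OF H(1)])
  moreover have "algebraic x" if "x \<in> E" for x
    using that hp(1) unfolding E_def roots_def by (auto intro!: algebraicI)
  moreover have "(\<exists>d>0. \<forall>x. \<bar>x - x0\<bar> < d \<longrightarrow> \<not> (\<exists>y. G x y)) \<or>
           (\<exists>a. \<exists>d>0. \<forall>x. \<bar>x - x0\<bar> < d \<longrightarrow>
              summable (\<lambda>k. a k * (x - x0) ^ k) \<and> G x (\<Sum>k. a k * (x - x0) ^ k))" if x0: "x0 \<notin> E" for x0
  proof -
    let ?p = "\<lambda>x P. P (base_env x) :: real poly"
    have "\<forall>\<^sub>F x in nhds x0. \<forall>h\<in>H. sgn (poly (hp h) x0) = sgn (poly (hp h) x)"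
      using x0 by (intro eventually_ball_finite H(1) ballI eventually_sgn_poly) (auto simp: E_def roots_def)
    then have near: "\<forall>\<^sub>F x in nhds x0. \<exists>R. sign_corr Q (?p x0) (?p x) R"
    proof eventually_elim
      case (elim x)
      then have "sign_agree H (base_env x0) (base_env x)" by (simp add: sign_agree_def hp(2))
      then show ?case by (rule H(3))
    qed
    have P_in_Q: "P f \<in> Q" if "f \<in> F" for f
      unfolding Q_def by (rule image_eqI[of _ _ "(f, 0)"]) (use that in \<open>auto simp: D_def\<close>)
    have G_eq: "G x y = G x' y'"
      if s: "\<And>f. f \<in> F \<Longrightarrow> sgn (poly (?p x (P f)) y) = sgn (poly (?p x' (P f)) y')" for x x' y y'
    proof -
      have "sign_agree F ((base_env x)(1 := y)) ((base_env x')(1 := y'))"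
        unfolding sign_agree_def using s by (intro ballI) (simp only: Pf)
      from F_sgn[OF this] show ?thesis by simp
    qed
    have G_corr: "G x0 y0 = G x y" if R: "sign_corr Q (?p x0) (?p x) R" and "R y0 y" for x y0 y R
      using sign_corr_sgn[OF R P_in_Q that(2)] by (rule G_eq)
    show ?thesis
    proof (cases "\<exists>y. G x0 y")
      case False
      have "\<forall>\<^sub>F x in nhds x0. \<not> (\<exists>y. G x y)"
        using near
      proof eventually_elim
        case (elim x)
        then obtain R where R: "sign_corr Q (?p x0) (?p x) R" by blast
        show ?case using False G_corr[OF R] sign_corr_right[OF R] by metis
      qed
      then show ?thesis unfolding eventually_nhds_metric dist_real_def by blast
    next
      case True
      then obtain y0 where y0: "G x0 y0" by blast
      have simple: "\<exists>P\<in>Q. poly (?p x0 P) z = 0 \<and> poly (pderiv (?p x0 P)) z \<noteq> 0"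
        if z: "z \<in> roots Q (?p x0)" for z
      proof -
        obtain f k where f: "f \<in> F" and k: "D f k (base_env x0) \<noteq> 0" "poly (D f k (base_env x0)) z = 0"
          using z unfolding roots_def Q_def by auto
        obtain m where m: "m < degree (P f (base_env x0))" "poly (D f m (base_env x0)) z = 0"
          "poly (pderiv (D f m (base_env x0))) z \<noteq> 0"
          using higher_pderiv_simple_root[of k "P f (base_env x0)" z] k unfolding D_def by blast
        have "degree (P f (base_env x0)) \<le> n" using P[OF f] by (simp add: param_poly_def)
        then have "D f m \<in> Q" using f m(1) unfolding Q_def by (intro image_eqI[of _ _ "(f, m)"]) auto
        with m(2,3) show ?thesis by blast
      qed
      \<comment> \<open>otherwise all signs, and with them \<open>G x0\<close>, would be unchanged near \<open>y0\<close>\<close>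
      have y0_root: "y0 \<in> roots Q (?p x0)"
      proof (rule ccontr)
        assume "y0 \<notin> roots Q (?p x0)"
        then have "\<forall>f\<in>F. ?p x0 (P f) = 0 \<or> poly (?p x0 (P f)) y0 \<noteq> 0"
          using P_in_Q unfolding roots_def by blast
        then have "\<forall>\<^sub>F y in nhds y0. \<forall>f\<in>F. sgn (poly (?p x0 (P f)) y0) = sgn (poly (?p x0 (P f)) y)"
          by (intro eventually_ball_finite F(1) ballI eventually_sgn_poly) blast
        then have "\<forall>\<^sub>F y in nhds y0. G x0 y"
          by eventually_elim (use y0 G_eq in blast)
        then obtain d where "d > 0" "\<And>y. dist y y0 < d \<Longrightarrow> G x0 y"
          unfolding eventually_nhds_metric by blast
        then have "G x0 (y0 + d / 2)" by (simp add: dist_real_def)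
        from unique[rule_format, OF this y0] show False using \<open>d > 0\<close> by simp
      qed
      obtain q where q: "q \<in> Q" "poly (?p x0 q) y0 = 0" "poly (pderiv (?p x0 q)) y0 \<noteq> 0"
        using simple[OF y0_root] by blast
      obtain c :: "nat \<Rightarrow> real poly" where c: "\<And>x y. poly (?p x q) y = (\<Sum>i\<le>n. poly (c i) x * y ^ i)"
        using param_poly_expand[of q n] q(1) Q(2) by blast
      have "((\<lambda>y. \<Sum>i\<le>n. poly (c i) x0 * y ^ i) has_real_derivative
          (\<Sum>i\<le>n. poly (c i) x0 * (of_nat i * y0 ^ (i - 1)))) (at y0)"
        by (auto intro!: derivative_eq_intros sum.cong)
      moreover have "((\<lambda>y. \<Sum>i\<le>n. poly (c i) x0 * y ^ i) has_real_derivative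
          poly (pderiv (?p x0 q)) y0) (at y0)"
        using poly_DERIV[of "?p x0 q" y0] by (simp add: c)
      ultimately have deriv: "(\<Sum>i\<le>n. poly (c i) x0 * (of_nat i * y0 ^ (i - 1))) = poly (pderiv (?p x0 q)) y0"
        by (rule DERIV_unique)
      have "(\<Sum>i\<le>n. poly (c i) x0 * y0 ^ i) = 0" using q(2) unfolding c .
      moreover have "(\<Sum>i\<le>n. poly (c i) x0 * (of_nat i * y0 ^ (i - 1))) \<noteq> 0"
        using q(3) unfolding deriv .
      ultimately have "\<exists>a d \<epsilon>. 0 < d \<and> 0 < \<epsilon> \<and> (\<forall>x. \<bar>x - x0\<bar> < d \<longrightarrow> summable (\<lambda>k. a k * (x - x0) ^ k) \<and>
          (\<forall>y. \<bar>y - y0\<bar> < \<epsilon> \<longrightarrow> (\<Sum>i\<le>n. poly (c i) x * y ^ i) = 0 \<longrightarrow> y = (\<Sum>k. a k * (x - x0) ^ k)))"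
        by (rule analytic_branch_real)
      then obtain a d \<epsilon> where "0 < d" "0 < \<epsilon>" and
        branch: "\<forall>x. \<bar>x - x0\<bar> < d \<longrightarrow> summable (\<lambda>k. a k * (x - x0) ^ k) \<and>
          (\<forall>y. \<bar>y - y0\<bar> < \<epsilon> \<longrightarrow> (\<Sum>i\<le>n. poly (c i) x * y ^ i) = 0 \<longrightarrow> y = (\<Sum>k. a k * (x - x0) ^ k))"
        by (elim exE conjE)
      have "\<forall>\<^sub>F x in nhds x0. \<bar>x - x0\<bar> < d"
        using \<open>0 < d\<close> unfolding eventually_nhds_metric dist_real_def by blast
      moreover have "\<forall>\<^sub>F x in nhds x0. \<forall>R z z'. sign_corr Q (?p x0) (?p x) R \<longrightarrow>
          z \<in> roots Q (?p x0) \<longrightarrow> R z z' \<longrightarrow> \<bar>z' - z\<bar> < \<epsilon>"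
        by (rule corresponding_roots_near[OF Q \<open>0 < \<epsilon>\<close>]) (rule simple)
      moreover note near
      ultimately
      have "\<forall>\<^sub>F x in nhds x0. summable (\<lambda>k. a k * (x - x0) ^ k) \<and> G x (\<Sum>k. a k * (x - x0) ^ k)"
      proof eventually_elim
        case (elim x)
        from elim(3) obtain R where R: "sign_corr Q (?p x0) (?p x) R" by blast
        obtain y where y: "R y0 y" using sign_corr_left[OF R] by blast
        have "\<bar>y - y0\<bar> < \<epsilon>" using elim(2) R y0_root y by blast
        moreover have "(\<Sum>i\<le>n. poly (c i) x * y ^ i) = 0"
          using sign_corr_sgn[OF R q(1) y] q(2) c[of x y] by (simp add: sgn_zero_iff)
        ultimately have "y = (\<Sum>k. a k * (x - x0) ^ k)" using branch[rule_format, OF elim(1)] by blast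
        moreover have "G x y" using G_corr[OF R y] y0 by simp
        ultimately show ?case using branch[rule_format, OF elim(1)] by simp
      qed
      then show ?thesis unfolding eventually_nhds_metric dist_real_def by blast
    qed
  qed
  ultimately show ?thesis by blast
qed

section \<open>Definability of the least admissible side\<close>

lemma semialgebraic_le:
  assumes "f \<in> int_poly" "g \<in> int_poly"
  shows "semialgebraic (\<lambda>e. f e \<le> g e)"
proof -
  have "(f e \<le> g e) = (f e' \<le> g e')" if "sign_agree {\<lambda>e. g e - f e} e e'" for e e'
  proof -
    have "sgn (g e - f e) = sgn (g e' - f e')" using that by (simp add: sign_agree_def)
    then show ?thesis by (auto simp: sgn_if split: if_splits)
  qed
  moreover have "{\<lambda>e. g e - f e} \<subseteq> int_poly" using int_poly_diff[OF assms(2,1)] by simp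
  ultimately show ?thesis unfolding semialgebraic_def
    by (intro exI[of _ "{\<lambda>e. g e - f e}"]) blast
qed

lemma semialgebraic_not: "semialgebraic \<phi> \<Longrightarrow> semialgebraic (\<lambda>e. \<not> \<phi> e)"
  unfolding semialgebraic_def by (elim ex_forward) auto

lemma semialgebraic_conj:
  assumes "semialgebraic \<phi>" "semialgebraic \<psi>"
  shows "semialgebraic (\<lambda>e. \<phi> e \<and> \<psi> e)"
proof -
  obtain F G where F: "finite F" "F \<subseteq> int_poly" "\<And>e e'. sign_agree F e e' \<Longrightarrow> \<phi> e = \<phi> e'"
    and G: "finite G" "G \<subseteq> int_poly" "\<And>e e'. sign_agree G e e' \<Longrightarrow> \<psi> e = \<psi> e'"
    using assms unfolding semialgebraic_def by blast
  have "(\<phi> e \<and> \<psi> e) = (\<phi> e' \<and> \<psi> e')" if "sign_agree (F \<union> G) e e'" for e e'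
    using F(3)[of e e'] G(3)[of e e'] that by (simp add: sign_agree_def)
  with F G show ?thesis unfolding semialgebraic_def by (intro exI[of _ "F \<union> G"]) simp
qed

lemma semialgebraic_imp:
  assumes "semialgebraic \<phi>" "semialgebraic \<psi>"
  shows "semialgebraic (\<lambda>e. \<phi> e \<longrightarrow> \<psi> e)"
proof -
  have "semialgebraic (\<lambda>e. \<not> (\<phi> e \<and> \<not> \<psi> e))"
    by (intro semialgebraic_not semialgebraic_conj assms)
  then show ?thesis by simp
qed

lemma semialgebraic_eq:
  assumes "f \<in> int_poly" "g \<in> int_poly"
  shows "semialgebraic (\<lambda>e. f e = g e)"
proof -
  have "semialgebraic (\<lambda>e. f e \<le> g e \<and> g e \<le> f e)"
    by (intro semialgebraic_conj semialgebraic_le assms)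
  then show ?thesis by (simp only: order_eq_iff)
qed

text \<open>The quantified variable is stored under an index \<open>k\<close> that does not occur in the formula, which is
  what the second premise says.\<close>

lemma semialgebraic_ex:
  assumes "semialgebraic (\<lambda>e. \<psi> (e k) e)" "\<And>x e. \<psi> x (e(k := x)) = \<psi> x e"
  shows "semialgebraic (\<lambda>e. \<exists>x. \<psi> x e)"
  using semialgebraic_projection[OF assms(1), of k] by (simp add: assms(2))

lemma semialgebraic_all:
  assumes "semialgebraic (\<lambda>e. \<psi> (e k) e)" "\<And>x e. \<psi> x (e(k := x)) = \<psi> x e"
  shows "semialgebraic (\<lambda>e. \<forall>x. \<psi> x e)"
proof -
  have "semialgebraic (\<lambda>e. \<not> (\<exists>x. \<not> \<psi> x e))"
    by (intro semialgebraic_not semialgebraic_ex[where k = k] assms(1)) (simp add: assms(2))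
  then show ?thesis by simp
qed

lemmas semialgebraic_intros = semialgebraic_le semialgebraic_eq semialgebraic_not
  semialgebraic_conj semialgebraic_imp

text \<open>In \<open>in_region\<close>, \<open>in_square\<close> and \<open>admissible_real\<close> square roots and quotients are replaced by
  quantified variables: \<open>t\<close> is \<open>sqrt r\<close>, the point \<open>(X, Y)\<close> is the point of tangency of the circles,
  and \<open>a\<close>, \<open>b\<close>, \<open>c\<close> are barycentric coordinates in the triangle.\<close>

definition in_region :: "real \<Rightarrow> real \<Rightarrow> real \<Rightarrow> bool" where
  "in_region r x y \<longleftrightarrow> (\<exists>t X Y a b c. 0 \<le> t \<and> t * t = r \<and> X * (1 + r) = 2 * t \<and> Y * (1 + r) = 2 * r \<and>
     0 \<le> a \<and> 0 \<le> b \<and> 0 \<le> c \<and> a + b + c = 1 \<and> x = b * (2 * t) + c * X \<and> y = c * Y \<and>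
     1 \<le> x^2 + (y - 1)^2 \<and> r^2 \<le> (x - 2 * t)^2 + (y - r)^2)"

definition in_square :: "real \<Rightarrow> real \<Rightarrow> real \<Rightarrow> real \<Rightarrow> real \<Rightarrow> real \<Rightarrow> bool" where
  "in_square p q v w x y \<longleftrightarrow> (\<exists>a b. 0 \<le> a \<and> a \<le> 1 \<and> 0 \<le> b \<and> b \<le> 1 \<and>
     x = p + a * v - b * w \<and> y = q + a * w + b * v)"

definition admissible_real :: "real \<Rightarrow> real \<Rightarrow> bool" where
  "admissible_real r s \<longleftrightarrow> (\<exists>p q v w. \<not> s = 0 \<and> 0 \<le> s \<and> s^2 = v^2 + w^2 \<and>
     (\<forall>x y. in_square p q v w x y \<longrightarrow> in_region r x y) \<and>
     (\<exists>x y. in_square p q v w x y \<and> x^2 + (y - 1)^2 = 1) \<and>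
     (\<exists>x y t. in_square p q v w x y \<and> 0 \<le> t \<and> t * t = r \<and> (x - 2 * t)^2 + (y - r)^2 = r^2) \<and>
     (\<exists>x y. in_square p q v w x y \<and> y = 0))"

text \<open>The variables are numbered as follows: \<open>0\<close> is the radius \<open>r\<close>, \<open>1\<close> the side \<open>s\<close>, \<open>2\<close> to \<open>5\<close> are the
  vertex and the side vector of the square, \<open>6\<close> and \<open>7\<close> the coordinates of a point, and indices from
  \<open>8\<close> on serve for the remaining quantifiers.\<close>

lemma semialgebraic_in_region: "semialgebraic (\<lambda>e. in_region (e 0) (e 6) (e 7))"
  unfolding in_region_def
  by (rule semialgebraic_ex[where k = 10], rule semialgebraic_ex[where k = 11],
      rule semialgebraic_ex[where k = 12], rule semialgebraic_ex[where k = 13],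
      rule semialgebraic_ex[where k = 14], rule semialgebraic_ex[where k = 15],
      intro semialgebraic_intros int_poly_intros, simp_all)

lemma semialgebraic_in_square:
  "semialgebraic (\<lambda>e. in_square (e 2) (e 3) (e 4) (e 5) (e 6) (e 7))"
  unfolding in_square_def
  by (rule semialgebraic_ex[where k = 10], rule semialgebraic_ex[where k = 11],
      intro semialgebraic_intros int_poly_intros, simp_all)

lemma semialgebraic_admissible_real:
  assumes "k \<notin> {2, 3, 4, 5}"
  shows "semialgebraic (\<lambda>e. admissible_real (e 0) (e k))"
proof -
  have contained: "semialgebraic (\<lambda>e. \<forall>x y. in_square (e 2) (e 3) (e 4) (e 5) x y \<longrightarrow> in_region (e 0) x y)"
    by (rule semialgebraic_all[where k = 6], rule semialgebraic_all[where k = 7],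
        intro semialgebraic_imp semialgebraic_in_square semialgebraic_in_region, simp_all)
  have touches_1: "semialgebraic (\<lambda>e. \<exists>x y. in_square (e 2) (e 3) (e 4) (e 5) x y \<and> x^2 + (y - 1)^2 = 1)"
    by (rule semialgebraic_ex[where k = 6], rule semialgebraic_ex[where k = 7],
        intro semialgebraic_in_square semialgebraic_intros int_poly_intros, simp_all)
  have touches_r: "semialgebraic (\<lambda>e. \<exists>x y t. in_square (e 2) (e 3) (e 4) (e 5) x y \<and>
      0 \<le> t \<and> t * t = e 0 \<and> (x - 2 * t)^2 + (y - e 0)^2 = (e 0)^2)"
    by (rule semialgebraic_ex[where k = 6], rule semialgebraic_ex[where k = 7],
        rule semialgebraic_ex[where k = 9],
        intro semialgebraic_in_square semialgebraic_intros int_poly_intros, simp_all)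
  have touches_L: "semialgebraic (\<lambda>e. \<exists>x y. in_square (e 2) (e 3) (e 4) (e 5) x y \<and> y = 0)"
    by (rule semialgebraic_ex[where k = 6], rule semialgebraic_ex[where k = 7],
        intro semialgebraic_in_square semialgebraic_intros int_poly_intros, simp_all)
  show ?thesis
    unfolding admissible_real_def using assms
    by - (rule semialgebraic_ex[where k = 2], rule semialgebraic_ex[where k = 3],
        rule semialgebraic_ex[where k = 4], rule semialgebraic_ex[where k = 5],
        intro contained touches_1 touches_r touches_L semialgebraic_intros int_poly_intros, simp_all)
qed

definition least_admissible :: "real \<Rightarrow> real \<Rightarrow> bool" where
  "least_admissible r s \<longleftrightarrow>
     1 \<le> r \<and> admissible_real r s \<and> (\<forall>t. admissible_real r t \<longrightarrow> s \<le> t)"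

lemma semialgebraic_least_admissible: "semialgebraic (\<lambda>e. least_admissible (e 0) (e 1))"
proof -
  have "semialgebraic (\<lambda>e. \<forall>t. admissible_real (e 0) t \<longrightarrow> e 1 \<le> t)"
    by (rule semialgebraic_all[where k = 8],
        intro semialgebraic_admissible_real semialgebraic_intros int_poly_intros, simp_all)
  moreover have "semialgebraic (\<lambda>e. admissible_real (e 0) (e 1))"
    by (rule semialgebraic_admissible_real) simp
  ultimately show ?thesis
    unfolding least_admissible_def by (intro semialgebraic_intros int_poly_intros)
qed

lemma mem_square_iff: "Complex x y \<in> square (Complex p q) (Complex v w) \<longleftrightarrow> in_square p q v w x y"
proof
  assume "in_square p q v w x y"
  then obtain a b where ab: "0 \<le> a" "a \<le> 1" "0 \<le> b" "b \<le> 1"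
    and xy: "x = p + a * v - b * w" "y = q + a * w + b * v"
    unfolding in_square_def by blast
  let ?K = "square (Complex p q) (Complex v w)"
  let ?P = "Complex p q" and ?v = "Complex v w"
  have K: "convex ?K" unfolding square_def by (rule convex_convex_hull)
  have corners: "?P \<in> ?K" "?P + ?v \<in> ?K" "?P + ?v + \<i> * ?v \<in> ?K" "?P + \<i> * ?v \<in> ?K"
    unfolding square_def by (auto intro: hull_inc)
  define A where "A = (1 - a) *\<^sub>R ?P + a *\<^sub>R (?P + ?v)"
  define B where "B = (1 - a) *\<^sub>R (?P + \<i> * ?v) + a *\<^sub>R (?P + ?v + \<i> * ?v)"
  have "A \<in> ?K" "B \<in> ?K" unfolding A_def B_def using corners ab by (auto intro!: convexD[OF K])
  then have "(1 - b) *\<^sub>R A + b *\<^sub>R B \<in> ?K" using ab by (auto intro!: convexD[OF K])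
  moreover have "(1 - b) *\<^sub>R A + b *\<^sub>R B = Complex x y"
    by (simp add: complex_eq_iff A_def B_def xy algebra_simps)
  ultimately show "Complex x y \<in> ?K" by simp
next
  assume "Complex x y \<in> square (Complex p q) (Complex v w)"
  moreover have "square (Complex p q) (Complex v w) \<subseteq> {z. in_square p q v w (Re z) (Im z)}"
    unfolding square_def
  proof (rule hull_minimal)
    show "{Complex p q, Complex p q + Complex v w, Complex p q + Complex v w + \<i> * Complex v w,
        Complex p q + \<i> * Complex v w} \<subseteq> {z. in_square p q v w (Re z) (Im z)}"
    proof -
      have "in_square p q v w p q" "in_square p q v w (p + v) (q + w)"
        unfolding in_square_def by (rule exI[of _ 0], rule exI[of _ 0], simp, rule exI[of _ 1], rule exI[of _ 0], simp)
      moreover have "in_square p q v w (p + v - w) (q + w + v)" "in_square p q v w (p - w) (q + v)"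
        unfolding in_square_def by (rule exI[of _ 1], rule exI[of _ 1], simp, rule exI[of _ 0], rule exI[of _ 1], simp)
      ultimately show ?thesis by (simp add: algebra_simps)
    qed
    show "convex {z. in_square p q v w (Re z) (Im z)}"
    proof (rule convexI, clarsimp)
      fix z z' and u u' :: real
      assume z: "in_square p q v w (Re z) (Im z)" and z': "in_square p q v w (Re z') (Im z')"
        and u: "0 \<le> u" "0 \<le> u'" "u + u' = 1"
      obtain a b where ab: "0 \<le> a" "a \<le> 1" "0 \<le> b" "b \<le> 1"
        "Re z = p + a * v - b * w" "Im z = q + a * w + b * v"
        using z unfolding in_square_def by blast
      obtain a' b' where ab': "0 \<le> a'" "a' \<le> 1" "0 \<le> b'" "b' \<le> 1"
        "Re z' = p + a' * v - b' * w" "Im z' = q + a' * w + b' * v"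
        using z' unfolding in_square_def by blast
      have p: "u * p + u' * p = p" and q: "u * q + u' * q = q"
        using u(3) by (simp_all flip: distrib_right)
      have "u * Re z + u' * Re z' = p + (u * a + u' * a') * v - (u * b + u' * b') * w"
        unfolding ab(5) ab'(5) using p by (simp add: algebra_simps)
      moreover have "u * Im z + u' * Im z' = q + (u * a + u' * a') * w + (u * b + u' * b') * v"
        unfolding ab(6) ab'(6) using q by (simp add: algebra_simps)
      moreover have "0 \<le> u * a + u' * a'" "0 \<le> u * b + u' * b'"
        using u ab ab' by simp_all
      moreover have "u * a + u' * a' \<le> 1" "u * b + u' * b' \<le> 1"
        using u ab ab' by (auto intro!: convex_bound_le)
      ultimately show "in_square p q v w (u * Re z + u' * Re z') (u * Im z + u' * Im z')"
        unfolding in_square_def by blast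
    qed
  qed
  ultimately show "in_square p q v w x y" by auto
qed

lemma le_dist_Complex_iff:
  assumes "0 \<le> \<rho>"
  shows "\<rho> \<le> dist (Complex a b) (Complex x y) \<longleftrightarrow> \<rho>\<^sup>2 \<le> (x - a)\<^sup>2 + (y - b)\<^sup>2"
proof -
  have "dist (Complex a b) (Complex x y) = sqrt ((x - a)\<^sup>2 + (y - b)\<^sup>2)"
    by (simp add: dist_norm cmod_def power2_commute)
  then show ?thesis using assms by (metis abs_of_nonneg real_sqrt_abs real_sqrt_le_iff)
qed

lemma dist_Complex_eq_iff:
  assumes "0 \<le> \<rho>"
  shows "dist (Complex a b) (Complex x y) = \<rho> \<longleftrightarrow> (x - a)\<^sup>2 + (y - b)\<^sup>2 = \<rho>\<^sup>2"
proof -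
  have "dist (Complex a b) (Complex x y) = sqrt ((x - a)\<^sup>2 + (y - b)\<^sup>2)"
    by (simp add: dist_norm cmod_def power2_commute)
  then show ?thesis using assms
    by (metis real_sqrt_abs abs_of_nonneg real_sqrt_eq_iff)
qed

lemma nonneg_square_root_iff: "0 \<le> r \<Longrightarrow> 0 \<le> t \<and> t * t = r \<longleftrightarrow> t = sqrt r"
  by (metis real_sqrt_ge_zero real_sqrt_mult_self real_sqrt_abs2 abs_of_nonneg)

lemma mem_region_iff:
  assumes "1 \<le> r"
  shows "Complex x y \<in> region r \<longleftrightarrow> in_region r x y"
proof -
  have "Complex x y \<in> convex hull {0, Complex (2 * sqrt r) 0, tangency_point r} \<longleftrightarrow>
      (\<exists>a b c. 0 \<le> a \<and> 0 \<le> b \<and> 0 \<le> c \<and> a + b + c = 1 \<and>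
        x = b * (2 * sqrt r) + c * (2 * sqrt r / (1 + r)) \<and> y = c * (2 * r / (1 + r)))"
    unfolding convex_hull_3 tangency_point_def by (simp add: complex_eq_iff) blast
  moreover have "Complex x y \<notin> ball center1 1 \<longleftrightarrow> 1 \<le> x\<^sup>2 + (y - 1)\<^sup>2"
    using le_dist_Complex_iff[of 1 0 1 x y] by (simp add: center1_def not_less)
  moreover have "Complex x y \<notin> ball (center_r r) r \<longleftrightarrow> r\<^sup>2 \<le> (x - 2 * sqrt r)\<^sup>2 + (y - r)\<^sup>2"
    using le_dist_Complex_iff[of r "2 * sqrt r" r x y] assms by (simp add: center_r_def not_less)
  moreover have "X * (1 + r) = z \<longleftrightarrow> X = z / (1 + r)" for X z
    using assms by (auto simp: field_simps)
  moreover have "0 \<le> t \<and> t * t = r \<and> \<phi> \<longleftrightarrow> t = sqrt r \<and> \<phi>" for t \<phi>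
    using nonneg_square_root_iff[of r t] assms by auto
  ultimately show ?thesis unfolding region_def in_region_def Diff_iff by simp blast
qed

lemma admissible_side_iff:
  assumes "1 \<le> r"
  shows "admissible_side r s \<longleftrightarrow> admissible_real r s"
proof -
  have ex: "(\<exists>z. \<phi> z) \<longleftrightarrow> (\<exists>a b. \<phi> (Complex a b))" and all: "(\<forall>z. \<phi> z) \<longleftrightarrow> (\<forall>a b. \<phi> (Complex a b))" for \<phi>
    by (metis complex.exhaust)+
  have side: "Complex v w \<noteq> 0 \<and> s = norm (Complex v w) \<and> \<phi> \<longleftrightarrow> s \<noteq> 0 \<and> 0 \<le> s \<and> s\<^sup>2 = v\<^sup>2 + w\<^sup>2 \<and> \<phi>" for v w \<phi>
    using real_sqrt_unique[of s "v\<^sup>2 + w\<^sup>2"] by (auto simp: cmod_def complex_eq_iff)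
  have r: "0 \<le> t \<and> t * t = r \<and> \<phi> \<longleftrightarrow> t = sqrt r \<and> \<phi>" for t \<phi>
    using nonneg_square_root_iff[of r t] assms by auto
  have "square (Complex p q) (Complex v w) \<subseteq> region r \<longleftrightarrow>
      (\<forall>x y. in_square p q v w x y \<longrightarrow> in_region r x y)" for p q v w
    unfolding subset_iff all mem_square_iff mem_region_iff[OF assms] ..
  moreover have "square (Complex p q) (Complex v w) \<inter> S \<noteq> {} \<longleftrightarrow>
      (\<exists>x y. in_square p q v w x y \<and> Complex x y \<in> S)" for p q v w S
    unfolding ex_in_conv[symmetric] ex Int_iff mem_square_iff ..
  moreover have "Complex x y \<in> sphere center1 1 \<longleftrightarrow> x\<^sup>2 + (y - 1)\<^sup>2 = 1" for x y
    using dist_Complex_eq_iff[of 1 0 1 x y] by (simp add: center1_def)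
  moreover have "Complex x y \<in> sphere (center_r r) r \<longleftrightarrow> (x - 2 * sqrt r)\<^sup>2 + (y - r)\<^sup>2 = r\<^sup>2" for x y
    using dist_Complex_eq_iff[of r "2 * sqrt r" r x y] assms by (simp add: center_r_def)
  moreover have "Complex x y \<in> line_L \<longleftrightarrow> y = 0" for x y by (simp add: line_L_def)
  ultimately show ?thesis
    unfolding admissible_side_def admissible_real_def ex side by (simp add: r)
qed

lemma mu_eq:
  assumes "least_admissible r s"
  shows "mu r = s"
  unfolding mu_def using assms admissible_side_iff[of r]
  by (intro Least_equality) (auto simp: least_admissible_def)

text \<open>\<open>LEAST\<close> is a definite description, and an unsatisfiable description does not depend on \<open>r\<close>.\<close>

lemma mu_eq_default:
  assumes "1 \<le> r" "\<And>s. \<not> least_admissible r s"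
  shows "mu r = (THE s. False)"
proof -
  have "(admissible_side r s \<and> (\<forall>t. admissible_side r t \<longrightarrow> s \<le> t)) = False" for s
    using assms(2)[of s] assms(1) unfolding least_admissible_def admissible_side_iff[OF assms(1)] by simp
  then show ?thesis unfolding mu_def Least_def by (simp only:)
qed

theorem theorem1p1:
  "\<exists>E :: real set. finite E \<and> E \<subseteq> {1..} \<and> (\<forall>e\<in>E. algebraic e) \<and>
     real_analytic_on mu ({1..} - E)"
proof -
  have "\<forall>r s s'. least_admissible r s \<longrightarrow> least_admissible r s' \<longrightarrow> s = s'"
    using mu_eq by blast
  from semialgebraic_function_analytic[of least_admissible, OF semialgebraic_least_admissible this]
  obtain E where E: "finite E" "\<forall>x\<in>E. algebraic x" and
    cases: "\<forall>x0. x0 \<notin> E \<longrightarrow>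
           (\<exists>d>0. \<forall>x. \<bar>x - x0\<bar> < d \<longrightarrow> \<not> (\<exists>y. least_admissible x y)) \<or>
           (\<exists>a. \<exists>d>0. \<forall>x. \<bar>x - x0\<bar> < d \<longrightarrow>
              summable (\<lambda>k. a k * (x - x0) ^ k) \<and> least_admissible x (\<Sum>k. a k * (x - x0) ^ k))"
    by (elim exE conjE)
  have "real_analytic_on mu ({1..} - E \<inter> {1..})"
    unfolding real_analytic_on_def
  proof
    fix x0 assume "x0 \<in> {1..} - E \<inter> {1..}"
    then have "x0 \<notin> E" by auto
    let ?goal = "\<exists>a. \<exists>e>0. \<forall>y. \<bar>y - x0\<bar> < e \<longrightarrow> summable (\<lambda>n. a n * (y - x0) ^ n) \<and>
        (y \<in> {1..} - E \<inter> {1..} \<longrightarrow> mu y = (\<Sum>n. a n * (y - x0) ^ n))"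
    from cases[rule_format, OF \<open>x0 \<notin> E\<close>] show ?goal
    proof (elim disjE exE conjE)
      fix d :: real
      assume d: "0 < d" "\<forall>x. \<bar>x - x0\<bar> < d \<longrightarrow> \<not> (\<exists>y. least_admissible x y)"
      define c :: real where "c = (THE s. False)"
      define a where "a n = (if n = 0 then c else 0)" for n :: nat
      have sums: "(\<lambda>n. a n * (y - x0) ^ n) sums c" for y
      proof -
        have "(\<lambda>n. a n * (y - x0) ^ n) = (\<lambda>n. if n = 0 then c else 0)"
          by (auto simp: a_def)
        then show ?thesis using sums_single[of 0 "\<lambda>_. c"] by simp
      qed
      have "mu y = (\<Sum>n. a n * (y - x0) ^ n)" if "\<bar>y - x0\<bar> < d" "1 \<le> y" for y
        using mu_eq_default[OF that(2)] d(2) that(1) sums_unique[OF sums, of y] by (simp add: c_def)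
      then show ?goal
        using d(1) sums_summable[OF sums] by (intro exI[of _ a] exI[of _ d]) simp
    next
      fix a d
      assume "0 < d" and branch: "\<forall>x. \<bar>x - x0\<bar> < d \<longrightarrow>
          summable (\<lambda>k. a k * (x - x0) ^ k) \<and> least_admissible x (\<Sum>k. a k * (x - x0) ^ k)"
      then show ?goal
        using mu_eq by (intro exI[of _ a] exI[of _ d]) blast
    qed
  qed
  with E show ?thesis by (intro exI[of _ "E \<inter> {1..}"]) auto
qed

end
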